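(* There exists an irrational number $0<\theta<1$ such that the spectral triple $(C_\infty(X^\theta),L^2(X^\theta,\mu),D_{X^\theta})$ has infinite Connes metric, where $X^\theta$ is the Sturmian subshift of parameter $\theta$ and $\mu$ is its unique invariant probability measure.
   Context: Sturmian subshifts. For irrational $0<\theta<1$, $X^\theta\subseteq\{0,1\}^{\mathbb{Z}}$ is the set of all sequences $w=(w_n)_{n\in\mathbb{Z}}$ such that, for some real number $x$ and for $I$ either $[0,1-\theta)$ or $(0,1-\theta]$, one has for all $n$: $w_n=0$ if $\{n\theta-x\}\in I$ and $w_n=1$ otherwise, where $\{y\}=y-\lfloor y\rfloor$. With the left shift $\sigma(x)_n=x_{n+1}$, $X^\theta$ is a minimal, uniquely ergodic subshift (well known); its unique invariant probability measure $\mu$ has support $X^\theta$. Spectral triple. Let $X=X^\theta$. For $n\ge1$, $X_n=\{(x_1,\dots,x_n):x\in X\}$. For $w\in X_n$, $U(w)=\{x\in X:(x_{-m},\dots,x_m)=w\}$ if $n=2m+1$, and $U(w)=\{x\in X:(x_{1-m},\dots,x_m)=w\}$ if $n=2m\ge2$; $\xi(w)$ is the characteristic function of $U(w)$. Set $C_{-1}=\{0\}$, $C_0=\mathbb{C}1$, $C_n=\mathrm{span}\{\xi(w):w\in X_n\}$ for $n\ge1$, viewed both in $C(X)$ and in $L^2(X,\mu)$; $C_\infty(X)=\bigcup_nC_n$, acting on $L^2(X,\mu)$ by multiplication. $D_X$ is the operator on $L^2(X,\mu)$ with domain $\{\sum_{n\ge0}\xi_n:\xi_n\in C_n\cap C_{n-1}^\perp,\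 \sum_n(n\|\xi_n\|)^2<\infty\}$ and $D_X\xi=n\xi$ for $\xi\in C_n\cap C_{n-1}^\perp$, $n\ge0$. For every $f\in C_\infty(X)$, $[D_X,f]$ extends to a bounded operator, whose norm is denoted $\|[D_X,f]\|$. Connes metric. On the state space of $C(X)$, $d(\phi,\psi)=\sup\{|\phi(f)-\psi(f)|: f\in C_\infty(X),\ \|[D_X,f]\|\le1\}\in[0,\infty]$. The Connes metric is called finite if $d(\phi,\psi)<\infty$ for all states $\phi,\psi$, and infinite otherwise (by the uniform boundedness principle, it is infinite if and only if the image of $\{f\in C_\infty(X):\|[D_X,f]\|\le1\}$ in $C(X)/\mathbb{C}1$ is unbounded for the quotient of the supremum norm). *)

theory Defs
  imports "HOL-Probability.Probability" "HOL-Library.Nonpos_Ints"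
begin

text \<open>
  Bi-infinite sequences have type \<^typ>\<open>int \<Rightarrow> nat\<close>, with the product of the discrete topologies.
  Functions on a subshift \<open>X\<close> are represented by functions on the whole type; only their values
  on \<open>X\<close> matter.
\<close>

definition sturmian :: "real \<Rightarrow> (int \<Rightarrow> nat) set" where
  "sturmian \<theta> = {w. \<exists>x::real. \<exists>I \<in> {{0..<1 - \<theta>}, {0<..1 - \<theta>}}.
     \<forall>n. w n = (if frac (of_int n * \<theta> - x) \<in> I then 0 else 1)}"

definition shift :: "(int \<Rightarrow> nat) \<Rightarrow> int \<Rightarrow> nat" where
  "shift x = (\<lambda>n. x (n + 1))"

definition invariant_probability :: "(int \<Rightarrow> nat) set \<Rightarrow> (int \<Rightarrow> nat) measure \<Rightarrow> bool" where
  "invariant_probability X M \<longleftrightarrow>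
     sets M = sets (restrict_space borel X) \<and> prob_space M \<and> distr M M shift = M"

text \<open>Only meaningful for uniquely ergodic \<open>X\<close>.\<close>

definition invariant_measure :: "(int \<Rightarrow> nat) set \<Rightarrow> (int \<Rightarrow> nat) measure" where
  "invariant_measure X = (THE M. invariant_probability X M)"

text \<open>
  The elements of \<open>L\<^sup>2(M)\<close> are represented by square-integrable functions; identification of
  functions agreeing almost everywhere is left implicit, so \<open>l2_norm\<close> is a seminorm.
\<close>

definition L2 :: "'a measure \<Rightarrow> ('a \<Rightarrow> complex) set" where
  "L2 M = {f. f \<in> borel_measurable M \<and> integrable M (\<lambda>x. (cmod (f x))\<^sup>2)}"

definition l2_inner :: "'a measure \<Rightarrow> ('a \<Rightarrow> complex) \<Rightarrow> ('a \<Rightarrow> complex) \<Rightarrow> complex" where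
  "l2_inner M f g = (LINT x|M. f x * cnj (g x))"

definition l2_norm :: "'a measure \<Rightarrow> ('a \<Rightarrow> complex) \<Rightarrow> real" where
  "l2_norm M f = sqrt (LINT x|M. (cmod (f x))\<^sup>2)"

definition l2_sums :: "'a measure \<Rightarrow> (nat \<Rightarrow> 'a \<Rightarrow> complex) \<Rightarrow> ('a \<Rightarrow> complex) \<Rightarrow> bool" where
  "l2_sums M p f \<longleftrightarrow> (\<lambda>N. l2_norm M (\<lambda>x. f x - (\<Sum>n<N. p n x))) \<longlonglongrightarrow> 0"

definition words :: "(int \<Rightarrow> nat) set \<Rightarrow> nat \<Rightarrow> nat list set" where
  "words X n = {map x [1..int n] | x. x \<in> X}"

text \<open>Coordinates \<open>-m, \<dots>, m\<close> if \<open>n = 2 m + 1\<close>, and \<open>1 - m, \<dots>, m\<close> if \<open>n = 2 m\<close>.\<close>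

definition window :: "nat \<Rightarrow> int list" where
  "window n = (let m = int (n div 2) in [(if odd n then - m else 1 - m)..m])"

definition cylinder :: "(int \<Rightarrow> nat) set \<Rightarrow> nat list \<Rightarrow> (int \<Rightarrow> nat) set" where
  "cylinder X w = {x \<in> X. map x (window (length w)) = w}"

lemma finite_words_sturmian: "finite (words (sturmian \<theta>) n)"
proof (rule finite_subset)
  have "w i = Suc 0" if "w \<in> sturmian \<theta>" "0 < w i" for w i
    using that unfolding sturmian_def by (smt (verit) One_nat_def less_numeral_extra(3) mem_Collect_eq)
  then show "words (sturmian \<theta>) n \<subseteq> {xs. set xs \<subseteq> {0, 1} \<and> length xs = n}"
    unfolding words_def by auto
  show "finite {xs::nat list. set xs \<subseteq> {0, 1} \<and> length xs = n}"
    by (rule finite_lists_length_eq) simp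
qed

text \<open>
  The spaces \<open>C\<^sub>k\<close> for \<open>k \<ge> -1\<close>. As \<^term>\<open>words X n\<close> is finite for the subshifts considered here,
  the last case is the complex span of the characteristic functions of the cylinders.
\<close>

definition C_space :: "(int \<Rightarrow> nat) set \<Rightarrow> int \<Rightarrow> ((int \<Rightarrow> nat) \<Rightarrow> complex) set" where
  "C_space X k =
     (if k < 0 then {\<lambda>x. 0}
      else if k = 0 then {\<lambda>x. c * indicator X x | c. True}
      else {\<lambda>x. \<Sum>w\<in>words X (nat k). a w * indicator (cylinder X w) x | a. True})"

definition C_inf :: "(int \<Rightarrow> nat) set \<Rightarrow> ((int \<Rightarrow> nat) \<Rightarrow> complex) set" where
  "C_inf X = (\<Union>n::nat. C_space X (int n))"

definition eigenspace ::
  "(int \<Rightarrow> nat) set \<Rightarrow> (int \<Rightarrow> nat) measure \<Rightarrow> nat \<Rightarrow> ((int \<Rightarrow> nat) \<Rightarrow> complex) set" where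
  "eigenspace X M n =
     {\<xi> \<in> C_space X (int n). \<forall>\<eta> \<in> C_space X (int n - 1). l2_inner M \<xi> \<eta> = 0}"

text \<open>
  The graph of \<open>D\<^sub>X\<close>: a pair \<open>(\<xi>, \<eta>)\<close> belongs to it iff (the class of) \<open>\<xi>\<close> is in the domain
  and \<open>D\<^sub>X \<xi> = \<eta>\<close> almost everywhere.
\<close>

definition dirac_graph ::
  "(int \<Rightarrow> nat) set \<Rightarrow> (int \<Rightarrow> nat) measure
     \<Rightarrow> (((int \<Rightarrow> nat) \<Rightarrow> complex) \<times> ((int \<Rightarrow> nat) \<Rightarrow> complex)) set" where
  "dirac_graph X M = {(\<xi>, \<eta>). \<xi> \<in> L2 M \<and> \<eta> \<in> L2 M \<and>
     (\<exists>p. (\<forall>n. p n \<in> eigenspace X M n) \<and>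
          summable (\<lambda>n. (real n * l2_norm M (p n))\<^sup>2) \<and>
          l2_sums M p \<xi> \<and> l2_sums M (\<lambda>n x. of_nat n * p n x) \<eta>)}"

text \<open>
  The norm of \<open>[D\<^sub>X, f] \<xi> = D\<^sub>X (f \<xi>) - f D\<^sub>X \<xi>\<close>, taken over the unit ball of its natural domain
  (those \<open>\<xi>\<close> such that \<open>\<xi>\<close> and \<open>f \<xi>\<close> are in the domain of \<open>D\<^sub>X\<close>). If this domain is dense,
  it is the norm of the bounded extension to \<open>L\<^sup>2\<close>, and \<open>\<infinity>\<close> if there is none.
\<close>

definition commutator_norm ::
  "(int \<Rightarrow> nat) set \<Rightarrow> (int \<Rightarrow> nat) measure \<Rightarrow> ((int \<Rightarrow> nat) \<Rightarrow> complex) \<Rightarrow> ennreal" where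
  "commutator_norm X M f =
     (SUP (\<xi>, \<eta>, \<zeta>) \<in> {(\<xi>, \<eta>, \<zeta>). (\<xi>, \<eta>) \<in> dirac_graph X M \<and>
          ((\<lambda>x. f x * \<xi> x), \<zeta>) \<in> dirac_graph X M \<and> l2_norm M \<xi> \<le> 1}.
        ennreal (l2_norm M (\<lambda>x. \<zeta> x - f x * \<eta> x)))"

text \<open>
  Positive unital linear functionals on \<open>C(X)\<close>. Linearity and positivity force \<open>\<phi> f\<close> to depend
  only on the restriction of \<open>f\<close> to \<open>X\<close>; the values of \<open>\<phi>\<close> off \<open>C(X)\<close> are irrelevant.
\<close>

definition is_state ::
  "(int \<Rightarrow> nat) set \<Rightarrow> (((int \<Rightarrow> nat) \<Rightarrow> complex) \<Rightarrow> complex) \<Rightarrow> bool" where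
  "is_state X \<phi> \<longleftrightarrow>
     (\<forall>f g. continuous_on X f \<longrightarrow> continuous_on X g \<longrightarrow> \<phi> (\<lambda>x. f x + g x) = \<phi> f + \<phi> g) \<and>
     (\<forall>c f. continuous_on X f \<longrightarrow> \<phi> (\<lambda>x. c * f x) = c * \<phi> f) \<and>
     (\<forall>f. continuous_on X f \<longrightarrow> (\<forall>x\<in>X. f x \<in> \<real>\<^sub>\<ge>\<^sub>0) \<longrightarrow> \<phi> f \<in> \<real>\<^sub>\<ge>\<^sub>0) \<and>
     \<phi> (\<lambda>x. 1) = 1"

definition connes_dist ::
  "(int \<Rightarrow> nat) set \<Rightarrow> (int \<Rightarrow> nat) measure \<Rightarrow> (((int \<Rightarrow> nat) \<Rightarrow> complex) \<Rightarrow> complex)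
     \<Rightarrow> (((int \<Rightarrow> nat) \<Rightarrow> complex) \<Rightarrow> complex) \<Rightarrow> ennreal" where
  "connes_dist X M \<phi> \<psi> =
     (SUP f \<in> {f \<in> C_inf X. commutator_norm X M f \<le> 1}. ennreal (cmod (\<phi> f - \<psi> f)))"

definition connes_metric_finite :: "(int \<Rightarrow> nat) set \<Rightarrow> (int \<Rightarrow> nat) measure \<Rightarrow> bool" where
  "connes_metric_finite X M \<longleftrightarrow>
     (\<forall>\<phi> \<psi>. is_state X \<phi> \<longrightarrow> is_state X \<psi> \<longrightarrow> connes_dist X M \<phi> \<psi> < \<infinity>)"

abbreviation connes_metric_infinite :: "(int \<Rightarrow> nat) set \<Rightarrow> (int \<Rightarrow> nat) measure \<Rightarrow> bool" where
  "connes_metric_infinite X M \<equiv> \<not> connes_metric_finite X M"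

end

theory Submission
  imports Defs
begin

text \<open>
  The sets \<open>words X n\<close> of a Sturmian subshift have \<open>n + 1\<close> elements, so passing from the window of
  length \<open>n - 1\<close> to the window of length \<open>n\<close> cuts a single cylinder \<open>I\<close> into two, \<open>J\<close> and \<open>I - J\<close>, of
  measures \<open>a\<close> and \<open>b\<close>. The natural test function is the Haar function of this cut, which is constant
  on \<open>J\<close> and on \<open>I - J\<close>, vanishes off \<open>I\<close> and has mean \<open>0\<close>. It lies in the \<open>n\<close>-th eigenspace, and its
  commutator with the Dirac operator is an operator between the sum of the lower eigenspaces, on whose
  elements it acts through their single value on \<open>I\<close>, and the \<open>n\<close>-th eigenspace. An element of norm \<open>1\<close>
  has modulus at most \<open>1 / sqrt (a + b)\<close> on \<open>I\<close>, so the commutator norm of \<open>f\<close> is at most of the order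
  of \<open>n\<^sup>2 * \<parallel>f\<parallel> / sqrt (a + b)\<close> (\<open>commutator_norm_le\<close>). When \<open>f\<close> is scaled to make this \<open>1\<close>, its value
  on \<open>J\<close> is of the order of \<open>sqrt (b / a) / n\<^sup>2\<close> (\<open>haar_function\<close>). The Connes metric is therefore
  infinite as soon as there are arbitrarily uneven cuts with a fixed point in the small piece \<open>J\<close> and another
  one outside.

  A Sturmian sequence is the itinerary of a point \<open>y\<close> of the circle under the rotation by \<open>\<theta>\<close>, and the
  cylinders are the arcs cut out by consecutive multiples of \<open>\<theta>\<close>. If \<open>p / q\<close> is a very good
  approximation of \<open>\<theta>\<close> from below and \<open>\<delta> = q * \<theta> - p\<close>, then among the multiples relevant for the
  window of length \<open>2 * q\<close> the arc to the right of \<open>0\<close> has length about \<open>1 / q\<close>, and the multiple \<open>q * \<theta>\<close>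
  that comes in at \<open>n = 2 * q + 1\<close> cuts off a piece of length \<open>\<delta>\<close>. This piece always contains the
  itinerary of \<open>0\<close>, and never that of \<open>1 / 2\<close>. So the values of the test functions at these two fixed
  points differ by at least a constant times \<open>1 / sqrt (q\<^sup>5 * \<delta>)\<close> (\<open>coding_separated\<close>), and the sum
  of the numbers \<open>2\<^sup>-\<^sup>m\<close>, where \<open>m\<close> runs over the powers of \<open>7\<close>, is a \<open>\<theta>\<close> for which \<open>q\<^sup>5 * \<delta>\<close> gets
  arbitrarily small (\<open>well_approximable_exists\<close>).

  The measures of arcs come from counting. The number of ones of a sequence between the places \<open>0\<close> and \<open>k\<close>
  is \<open>\<lfloor>k * \<theta>\<rfloor>\<close> or \<open>\<lfloor>k * \<theta>\<rfloor> + 1\<close>, and the sets where the first case holds, for varying \<open>k\<close>,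
  form a chain, each corresponding to an arc that starts at \<open>0\<close>. Invariance fixes the mean of the
  number of ones, hence the measures of these sets (\<open>measure_lower\<close>); as they generate the Borel
  sets, the invariant probability measure is unique.
\<close>

section \<open>Square-integrable functions\<close>

lemma integrable_L2_product:
  assumes "f \<in> L2 M" "g \<in> L2 M"
  shows "integrable M (\<lambda>x. cmod (f x) * cmod (g x))"
proof (rule Bochner_Integration.integrable_bound)
  have [measurable]: "f \<in> borel_measurable M" "g \<in> borel_measurable M"
    using assms by (auto simp: L2_def)
  show "integrable M (\<lambda>x. (cmod (f x))\<^sup>2 + (cmod (g x))\<^sup>2)"
    using assms by (auto simp: L2_def)
  show "(\<lambda>x. cmod (f x) * cmod (g x)) \<in> borel_measurable M" by measurable
  have "a * b \<le> a\<^sup>2 + b\<^sup>2" if "0 \<le> a" "0 \<le> b" for a b :: real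
    using sum_squares_bound[of a b] mult_nonneg_nonneg[OF that] by linarith
  then show "AE x in M. norm (cmod (f x) * cmod (g x)) \<le> norm ((cmod (f x))\<^sup>2 + (cmod (g x))\<^sup>2)"
    by auto
qed

lemma integrable_l2_inner:
  assumes "f \<in> L2 M" "g \<in> L2 M"
  shows "integrable M (\<lambda>x. f x * cnj (g x))"
proof (rule Bochner_Integration.integrable_bound[OF integrable_L2_product[OF assms]])
  have [measurable]: "f \<in> borel_measurable M" "g \<in> borel_measurable M"
    using assms by (auto simp: L2_def)
  have [measurable]: "(\<lambda>x. cnj (g x)) \<in> borel_measurable M"
    by (rule borel_measurable_continuous_on[where f = cnj]) (auto intro: continuous_intros)
  show "(\<lambda>x. f x * cnj (g x)) \<in> borel_measurable M" by measurable
qed (simp add: norm_mult)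

lemma L2_add: "f \<in> L2 M \<Longrightarrow> g \<in> L2 M \<Longrightarrow> (\<lambda>x. f x + g x) \<in> L2 M"
proof -
  assume fg: "f \<in> L2 M" "g \<in> L2 M"
  then have [measurable]: "f \<in> borel_measurable M" "g \<in> borel_measurable M"
    by (auto simp: L2_def)
  have "integrable M (\<lambda>x. (cmod (f x + g x))\<^sup>2)"
  proof (rule Bochner_Integration.integrable_bound)
    show "integrable M (\<lambda>x. (cmod (f x))\<^sup>2 + 2 * (cmod (f x) * cmod (g x)) + (cmod (g x))\<^sup>2)"
      using fg integrable_L2_product[OF fg] by (auto simp: L2_def)
    have "(cmod (a + b))\<^sup>2 \<le> (cmod a)\<^sup>2 + 2 * (cmod a * cmod b) + (cmod b)\<^sup>2" for a b
      using power_mono[OF norm_triangle_ineq[of a b], of 2]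
      by (simp add: power2_eq_square algebra_simps)
    then show "AE x in M. norm ((cmod (f x + g x))\<^sup>2)
        \<le> norm ((cmod (f x))\<^sup>2 + 2 * (cmod (f x) * cmod (g x)) + (cmod (g x))\<^sup>2)"
      by auto
  qed measurable
  then show ?thesis by (auto simp: L2_def)
qed

lemma L2_bounded_mult:
  assumes "f \<in> borel_measurable M" "\<And>x. cmod (f x) \<le> B" "g \<in> L2 M"
  shows "(\<lambda>x. f x * g x) \<in> L2 M"
proof -
  have [measurable]: "f \<in> borel_measurable M" "g \<in> borel_measurable M"
    using assms by (auto simp: L2_def)
  have "integrable M (\<lambda>x. (cmod (f x * g x))\<^sup>2)"
  proof (rule Bochner_Integration.integrable_bound)
    show "integrable M (\<lambda>x. B\<^sup>2 * (cmod (g x))\<^sup>2)"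
      using assms by (auto simp: L2_def)
    show "AE x in M. norm ((cmod (f x * g x))\<^sup>2) \<le> norm (B\<^sup>2 * (cmod (g x))\<^sup>2)"
      using assms(2) by (auto simp: norm_mult power_mult_distrib intro!: mult_right_mono power_mono)
  qed measurable
  then show ?thesis by (auto simp: L2_def)
qed

lemma L2_cmult: "g \<in> L2 M \<Longrightarrow> (\<lambda>x. c * g x) \<in> L2 M"
  by (rule L2_bounded_mult[where B = "cmod c"]) auto

lemma L2_diff: "f \<in> L2 M \<Longrightarrow> g \<in> L2 M \<Longrightarrow> (\<lambda>x. f x - g x) \<in> L2 M"
  using L2_add[of f M "\<lambda>x. (-1) * g x"] L2_cmult[of g M "-1"] by simp

lemma L2_zero: "(\<lambda>x. 0) \<in> L2 M"
  by (simp add: L2_def)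

lemma L2_sum: "(\<And>i. i \<in> I \<Longrightarrow> f i \<in> L2 M) \<Longrightarrow> (\<lambda>x. \<Sum>i\<in>I. f i x) \<in> L2 M"
  by (induction I rule: infinite_finite_induct) (auto intro: L2_add L2_zero)

lemma l2_norm_nonneg: "0 \<le> l2_norm M f"
  by (simp add: l2_norm_def)

lemma l2_norm_power2: "(l2_norm M f)\<^sup>2 = (LINT x|M. (cmod (f x))\<^sup>2)"
  by (simp add: l2_norm_def)

lemma l2_inner_self: "l2_inner M f f = of_real ((l2_norm M f)\<^sup>2)"
proof -
  have "f x * cnj (f x) = complex_of_real ((cmod (f x))\<^sup>2)" for x
    by (rule complex_norm_square[symmetric])
  then show ?thesis by (simp only: l2_inner_def l2_norm_power2 integral_complex_of_real)
qed

lemma l2_inner_commute: "l2_inner M g f = cnj (l2_inner M f g)"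
  by (simp add: l2_inner_def mult.commute flip: Bochner_Integration.integral_cnj)

lemma l2_norm_cmult: "l2_norm M (\<lambda>x. c * f x) = cmod c * l2_norm M f"
  by (simp add: l2_norm_def norm_mult power_mult_distrib real_sqrt_mult)

lemma integral_L2_product_le:
  assumes "f \<in> L2 M" "g \<in> L2 M"
  shows "(LINT x|M. cmod (f x) * cmod (g x)) \<le> l2_norm M f * l2_norm M g"
proof (rule power2_le_imp_le)
  have [measurable]: "f \<in> borel_measurable M" "g \<in> borel_measurable M"
    using assms by (auto simp: L2_def)
  let ?F = "LINT x|M. (cmod (f x))\<^sup>2" and ?G = "LINT x|M. (cmod (g x))\<^sup>2"
  let ?P = "LINT x|M. cmod (f x) * cmod (g x)"
  have F: "(\<integral>\<^sup>+x. (ennreal (cmod (f x)))\<^sup>2 \<partial>M) = ennreal ?F"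
    using assms by (subst nn_integral_eq_integral[symmetric]) (auto simp: L2_def ennreal_power)
  have G: "(\<integral>\<^sup>+x. (ennreal (cmod (g x)))\<^sup>2 \<partial>M) = ennreal ?G"
    using assms by (subst nn_integral_eq_integral[symmetric]) (auto simp: L2_def ennreal_power)
  have P: "(\<integral>\<^sup>+x. ennreal (cmod (f x)) * ennreal (cmod (g x)) \<partial>M) = ennreal ?P"
    using integrable_L2_product[OF assms]
    by (subst nn_integral_eq_integral[symmetric]) (auto simp: ennreal_mult)
  have "(ennreal ?P)\<^sup>2 \<le> ennreal ?F * ennreal ?G"
    using Cauchy_Schwarz_nn_integral[of "\<lambda>x. ennreal (cmod (f x))" M "\<lambda>x. ennreal (cmod (g x))"]
    by (simp add: F G P)
  then have "ennreal (?P\<^sup>2) \<le> ennreal (?F * ?G)"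
    by (simp add: ennreal_power ennreal_mult)
  then have "?P\<^sup>2 \<le> ?F * ?G"
    by (subst (asm) ennreal_le_iff) auto
  then show "?P\<^sup>2 \<le> (l2_norm M f * l2_norm M g)\<^sup>2"
    by (simp add: power_mult_distrib l2_norm_power2)
qed (simp add: l2_norm_nonneg)

lemma l2_inner_le:
  assumes "f \<in> L2 M" "g \<in> L2 M"
  shows "cmod (l2_inner M f g) \<le> l2_norm M f * l2_norm M g"
proof -
  have "cmod (l2_inner M f g) \<le> (LINT x|M. cmod (f x * cnj (g x)))"
    unfolding l2_inner_def by (rule integral_norm_bound)
  also have "\<dots> \<le> l2_norm M f * l2_norm M g"
    using integral_L2_product_le[OF assms] by (simp add: norm_mult)
  finally show ?thesis .
qed

lemma l2_norm_triangle:
  assumes "f \<in> L2 M" "g \<in> L2 M"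
  shows "l2_norm M (\<lambda>x. f x + g x) \<le> l2_norm M f + l2_norm M g"
proof (rule power2_le_imp_le)
  have "(l2_norm M (\<lambda>x. f x + g x))\<^sup>2
      \<le> (LINT x|M. (cmod (f x))\<^sup>2 + 2 * (cmod (f x) * cmod (g x)) + (cmod (g x))\<^sup>2)"
    unfolding l2_norm_power2
  proof (rule integral_mono)
    show "integrable M (\<lambda>x. (cmod (f x + g x))\<^sup>2)"
      using L2_add[OF assms] by (simp add: L2_def)
    show "integrable M (\<lambda>x. (cmod (f x))\<^sup>2 + 2 * (cmod (f x) * cmod (g x)) + (cmod (g x))\<^sup>2)"
      using assms integrable_L2_product[OF assms] by (auto simp: L2_def)
    show "(cmod (f x + g x))\<^sup>2 \<le> (cmod (f x))\<^sup>2 + 2 * (cmod (f x) * cmod (g x)) + (cmod (g x))\<^sup>2" for x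
      using power_mono[OF norm_triangle_ineq[of "f x" "g x"], of 2]
      by (simp add: power2_eq_square algebra_simps)
  qed
  also have "\<dots> = (l2_norm M f)\<^sup>2 + 2 * (LINT x|M. cmod (f x) * cmod (g x)) + (l2_norm M g)\<^sup>2"
    using assms integrable_L2_product[OF assms] by (simp add: L2_def l2_norm_power2)
  also have "\<dots> \<le> (l2_norm M f + l2_norm M g)\<^sup>2"
    using integral_L2_product_le[OF assms] by (simp add: power2_eq_square algebra_simps)
  finally show "(l2_norm M (\<lambda>x. f x + g x))\<^sup>2 \<le> (l2_norm M f + l2_norm M g)\<^sup>2" .
qed (simp add: l2_norm_nonneg)

lemma l2_norm_minus: "l2_norm M (\<lambda>x. - f x) = l2_norm M f"
  using l2_norm_cmult[of M "-1" f] by simp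

lemma l2_norm_diff_le:
  assumes "f \<in> L2 M" "g \<in> L2 M"
  shows "l2_norm M (\<lambda>x. f x - g x) \<le> l2_norm M f + l2_norm M g"
  using l2_norm_triangle[OF assms(1) L2_cmult[OF assms(2), of "-1"]] by (simp add: l2_norm_minus)

lemma l2_norm_sum_le:
  assumes "\<And>i. i \<in> I \<Longrightarrow> f i \<in> L2 M"
  shows "l2_norm M (\<lambda>x. \<Sum>i\<in>I. f i x) \<le> (\<Sum>i\<in>I. l2_norm M (f i))"
  using assms
proof (induction I rule: infinite_finite_induct)
  case (insert i I)
  have "l2_norm M (\<lambda>x. f i x + (\<Sum>i\<in>I. f i x)) \<le> l2_norm M (f i) + l2_norm M (\<lambda>x. \<Sum>i\<in>I. f i x)"
    using insert.prems by (intro l2_norm_triangle L2_sum) auto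
  then show ?case using insert by force
qed (auto simp: l2_norm_def)

lemma l2_norm_bounded_mult_le:
  assumes "f \<in> borel_measurable M" "\<And>x. cmod (f x) \<le> B" "g \<in> L2 M"
  shows "l2_norm M (\<lambda>x. f x * g x) \<le> B * l2_norm M g"
proof -
  have B: "0 \<le> B" using assms(2) norm_ge_zero order_trans by blast
  have "(LINT x|M. (cmod (f x * g x))\<^sup>2) \<le> (LINT x|M. B\<^sup>2 * (cmod (g x))\<^sup>2)"
    using L2_bounded_mult[OF assms] assms(2,3)
    by (intro integral_mono)
       (auto simp: L2_def norm_mult power_mult_distrib intro!: mult_right_mono power_mono)
  then have "(l2_norm M (\<lambda>x. f x * g x))\<^sup>2 \<le> (B * l2_norm M g)\<^sup>2"
    by (simp add: l2_norm_power2 power_mult_distrib)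
  then show ?thesis
    using B by (auto intro: power2_le_imp_le simp: l2_norm_nonneg)
qed

lemma l2_inner_diff_left:
  assumes "f \<in> L2 M" "g \<in> L2 M" "h \<in> L2 M"
  shows "l2_inner M (\<lambda>x. f x - g x) h = l2_inner M f h - l2_inner M g h"
  using assms by (simp add: l2_inner_def left_diff_distrib integrable_l2_inner)

lemma l2_inner_sum_left:
  assumes "\<And>i. i \<in> I \<Longrightarrow> f i \<in> L2 M" "h \<in> L2 M"
  shows "l2_inner M (\<lambda>x. \<Sum>i\<in>I. f i x) h = (\<Sum>i\<in>I. l2_inner M (f i) h)"
  using assms unfolding l2_inner_def
  by (subst sum_distrib_right, subst Bochner_Integration.integral_sum) (auto intro: integrable_l2_inner)

lemma l2_inner_real_mult:
  assumes "\<And>x. cnj (f x) = f x"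
  shows "l2_inner M (\<lambda>x. f x * u x) v = l2_inner M u (\<lambda>x. f x * v x)"
  by (simp add: l2_inner_def assms mult_ac)

text \<open>
  Used for \<open>p\<close> and \<open>p'\<close> the eigencomponents of \<open>\<xi>\<close> and \<open>f \<xi>\<close>, and again for these components
  weighted by their eigenvalues: the commutator is then expanded in the differences \<open>p' i - f p i\<close>.
\<close>

lemma l2_sums_combine:
  assumes "l2_sums M p' \<zeta>" "l2_sums M p \<eta>"
    and L2: "\<zeta> \<in> L2 M" "\<eta> \<in> L2 M" "\<And>i. p i \<in> L2 M" "\<And>i. p' i \<in> L2 M"
    and f: "f \<in> borel_measurable M" "\<And>x. cmod (f x) \<le> B"
  shows "l2_sums M (\<lambda>i x. p' i x - f x * p i x) (\<lambda>x. \<zeta> x - f x * \<eta> x)"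
  unfolding l2_sums_def
proof (rule Lim_null_comparison)
  show "(\<lambda>N. l2_norm M (\<lambda>x. \<zeta> x - (\<Sum>i<N. p' i x)) + B * l2_norm M (\<lambda>x. \<eta> x - (\<Sum>i<N. p i x))) \<longlonglongrightarrow> 0"
    using assms(1,2) unfolding l2_sums_def by (intro tendsto_add_zero tendsto_mult_right_zero)
  have "l2_norm M (\<lambda>x. (\<zeta> x - f x * \<eta> x) - (\<Sum>i<N. p' i x - f x * p i x))
      \<le> l2_norm M (\<lambda>x. \<zeta> x - (\<Sum>i<N. p' i x)) + B * l2_norm M (\<lambda>x. \<eta> x - (\<Sum>i<N. p i x))" for N
  proof -
    have u: "(\<lambda>x. \<zeta> x - (\<Sum>i<N. p' i x)) \<in> L2 M" and v: "(\<lambda>x. \<eta> x - (\<Sum>i<N. p i x)) \<in> L2 M"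
      using L2 by (auto intro!: L2_diff L2_sum)
    have "(\<lambda>x. (\<zeta> x - f x * \<eta> x) - (\<Sum>i<N. p' i x - f x * p i x))
        = (\<lambda>x. (\<zeta> x - (\<Sum>i<N. p' i x)) - f x * (\<eta> x - (\<Sum>i<N. p i x)))"
      by (simp add: sum_subtractf sum_distrib_left algebra_simps)
    then show ?thesis
      using l2_norm_diff_le[OF u L2_bounded_mult[OF f v]] l2_norm_bounded_mult_le[OF f v] by simp
  qed
  then show "\<forall>\<^sub>F N in sequentially. norm (l2_norm M (\<lambda>x. (\<zeta> x - f x * \<eta> x) - (\<Sum>i<N. p' i x - f x * p i x)))
      \<le> l2_norm M (\<lambda>x. \<zeta> x - (\<Sum>i<N. p' i x)) + B * l2_norm M (\<lambda>x. \<eta> x - (\<Sum>i<N. p i x))"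
    by (simp add: l2_norm_nonneg)
qed

lemma l2_sums_truncate:
  assumes "l2_sums M d u" and L2: "u \<in> L2 M" "\<And>i. d i \<in> L2 M"
    and null: "\<And>i. n < i \<Longrightarrow> l2_norm M (d i) = 0"
  shows "l2_norm M (\<lambda>x. u x - (\<Sum>i\<le>n. d i x)) = 0"
proof -
  have le: "l2_norm M (\<lambda>x. u x - (\<Sum>i\<le>n. d i x)) \<le> l2_norm M (\<lambda>x. u x - (\<Sum>i<N. d i x))" if "n < N" for N
  proof -
    have split: "{..<N} = {..n} \<union> {n<..<N}" using that by auto
    have "(\<lambda>x. u x - (\<Sum>i\<le>n. d i x)) = (\<lambda>x. (u x - (\<Sum>i<N. d i x)) + (\<Sum>i\<in>{n<..<N}. d i x))"
      unfolding split by (subst sum.union_disjoint) auto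
    then have "l2_norm M (\<lambda>x. u x - (\<Sum>i\<le>n. d i x))
        \<le> l2_norm M (\<lambda>x. u x - (\<Sum>i<N. d i x)) + l2_norm M (\<lambda>x. \<Sum>i\<in>{n<..<N}. d i x)"
      using l2_norm_triangle[of "\<lambda>x. u x - (\<Sum>i<N. d i x)" M "\<lambda>x. \<Sum>i\<in>{n<..<N}. d i x"] L2
      by (simp add: L2_diff L2_sum)
    moreover have "l2_norm M (\<lambda>x. \<Sum>i\<in>{n<..<N}. d i x) \<le> (\<Sum>i\<in>{n<..<N}. l2_norm M (d i))"
      by (rule l2_norm_sum_le) (rule L2)
    moreover have "(\<Sum>i\<in>{n<..<N}. l2_norm M (d i)) = 0"
      using null by simp
    ultimately show ?thesis by linarith
  qed
  have "l2_norm M (\<lambda>x. u x - (\<Sum>i\<le>n. d i x)) \<le> 0"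
    using assms(1) le unfolding l2_sums_def
    by (intro tendsto_lowerbound[where F = sequentially]) (auto intro: eventually_sequentiallyI[of "Suc n"])
  then show ?thesis using l2_norm_nonneg[of M] by (metis order_antisym)
qed

section \<open>Functions of finitely many coordinates\<close>

lemma window_eq: "window n = [1 - int (Suc n div 2)..int (n div 2)]"
  by (cases "even n") (auto simp: window_def Let_def elim!: evenE oddE)

lemma half_add_half: "n div 2 + Suc n div 2 = n"
  by (cases "even n") (auto elim!: evenE oddE)

lemma length_window: "length (window n) = n"
  using half_add_half[of n] unfolding window_eq length_upto by linarith

lemma set_window_mono:
  assumes "m \<le> n" shows "set (window m) \<subseteq> set (window n)"
  using div_le_mono[OF assms, of 2] div_le_mono[of "Suc m" "Suc n" 2] assms
  unfolding window_eq by auto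

lemma window_translate: "\<exists>d. window n = map (\<lambda>i. i + d) [1..int n]"
proof -
  have upto: "[a + c..b + c] = map (\<lambda>i. i + c) [a..b]" for a b c :: int
    by (rule nth_equalityI) (simp_all add: nth_upto)
  have "int n - int (Suc n div 2) = int (n div 2)"
    using half_add_half[of n] by linarith
  then have "window n = map (\<lambda>i. i + (- int (Suc n div 2))) [1..int n]"
    using upto[of 1 "- int (Suc n div 2)" "int n"] by (simp add: window_eq)
  then show ?thesis by blast
qed

locale subshift_measure = prob_space M for M :: "(int \<Rightarrow> nat) measure" +
  fixes X :: "(int \<Rightarrow> nat) set"
  assumes sets_eq: "sets M = sets (restrict_space borel X)"
    and translate: "x \<in> X \<Longrightarrow> (\<lambda>i. x (i + c)) \<in> X"
    and finite_words: "finite (words X n)"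
begin

lemma space_eq: "space M = X"
  using sets_eq_imp_space_eq[OF sets_eq] by (simp add: space_restrict_space)

text \<open>
  Words are read off at the places \<open>1, \<dots>, n\<close>, cylinders at the window. By translation invariance
  of the subshift both see the same words.
\<close>

lemma words_eq_window: "words X n = {map x (window n) | x. x \<in> X}"
proof -
  obtain d where d: "window n = map (\<lambda>i. i + d) [1..int n]"
    using window_translate by blast
  show ?thesis
  proof (intro equalityI subsetI)
    fix w assume "w \<in> words X n"
    then obtain x where x: "x \<in> X" "w = map x [1..int n]" by (auto simp: words_def)
    have "w = map (\<lambda>i. x (i + (- d))) (window n)" by (simp add: x d)
    then show "w \<in> {map x (window n) | x. x \<in> X}" using translate[OF x(1)] by blast
  next
    fix w assume "w \<in> {map x (window n) | x. x \<in> X}"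
    then obtain x where x: "x \<in> X" "w = map x (window n)" by blast
    have "w = map (\<lambda>i. x (i + d)) [1..int n]" by (simp add: x d)
    then show "w \<in> words X n" using translate[OF x(1)] unfolding words_def by blast
  qed
qed

text \<open>
  The description without linear combinations makes it plain that these spaces increase with \<open>n\<close> and
  are closed under products.
\<close>

lemma C_space_eq:
  "C_space X (int n) = {g. (\<forall>x. x \<notin> X \<longrightarrow> g x = 0) \<and>
     (\<forall>x\<in>X. \<forall>y\<in>X. (\<forall>i\<in>set (window n). x i = y i) \<longrightarrow> g x = g y)}" (is "_ = ?R")
proof (cases "n = 0")
  case True
  have w0: "window 0 = []" by (simp add: window_def)
  show ?thesis
  proof (intro equalityI subsetI)
    fix g assume "g \<in> C_space X (int n)"
    then show "g \<in> ?R" by (auto simp: C_space_def True w0)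
  next
    fix g assume g: "g \<in> ?R"
    have "\<forall>x\<in>X. \<forall>y\<in>X. g x = g y"
      using g unfolding True w0 list.set by blast
    then obtain c where "\<forall>x\<in>X. g x = c" by blast
    moreover have "\<forall>x. x \<notin> X \<longrightarrow> g x = 0" using g by blast
    ultimately have "g = (\<lambda>x. c * indicator X x)"
      by (auto simp: fun_eq_iff indicator_def)
    then show "g \<in> C_space X (int n)" by (auto simp: C_space_def True)
  qed
next
  case False
  have sum_eq: "(\<Sum>w\<in>words X n. a w * indicator (cylinder X w) x)
      = (if x \<in> X then a (map x (window n)) else 0)" for a :: "nat list \<Rightarrow> complex" and x
  proof -
    have "(\<Sum>w\<in>words X n. a w * indicator (cylinder X w) x)
        = (\<Sum>w\<in>words X n. if w = map x (window n) then (if x \<in> X then a w else 0) else 0)"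
      by (rule sum.cong) (auto simp: words_eq_window cylinder_def length_window indicator_def)
    also have "\<dots> = (if x \<in> X then a (map x (window n)) else 0)"
      using finite_words by (auto simp: words_eq_window)
    finally show ?thesis .
  qed
  have C: "C_space X (int n) = {\<lambda>x. if x \<in> X then a (map x (window n)) else 0 | a. True}"
    using False by (simp add: C_space_def sum_eq)
  show ?thesis
  proof (intro equalityI subsetI)
    fix g assume "g \<in> C_space X (int n)"
    then obtain a where g: "g = (\<lambda>x. if x \<in> X then a (map x (window n)) else 0)"
      unfolding C by blast
    show "g \<in> ?R"
      unfolding g by (auto intro!: arg_cong[where f = a])
  next
    fix g assume g: "g \<in> ?R"
    define a where "a w = g (SOME x. x \<in> X \<and> map x (window n) = w)" for w
    have "a (map x (window n)) = g x" if "x \<in> X" for x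
    proof -
      let ?y = "SOME y. y \<in> X \<and> map y (window n) = map x (window n)"
      have "?y \<in> X \<and> map ?y (window n) = map x (window n)"
        by (rule someI[of _ x]) (use that in simp)
      then have "?y \<in> X" "\<forall>i\<in>set (window n). ?y i = x i" by simp_all
      then have "g ?y = g x" using g that by blast
      then show ?thesis by (simp add: a_def)
    qed
    moreover have "\<forall>x. x \<notin> X \<longrightarrow> g x = 0" using g by blast
    ultimately have "g = (\<lambda>x. if x \<in> X then a (map x (window n)) else 0)"
      by (auto simp: fun_eq_iff)
    then show "g \<in> C_space X (int n)" unfolding C by blast
  qed
qed

lemma C_spaceI:
  assumes "\<And>x. x \<notin> X \<Longrightarrow> g x = 0"
    and "\<And>x y. x \<in> X \<Longrightarrow> y \<in> X \<Longrightarrow> \<forall>i\<in>set (window n). x i = y i \<Longrightarrow> g x = g y"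
  shows "g \<in> C_space X (int n)"
  unfolding C_space_eq using assms by blast

lemma C_space_outside: "g \<in> C_space X (int n) \<Longrightarrow> x \<notin> X \<Longrightarrow> g x = 0"
  unfolding C_space_eq by blast

lemma C_space_agree:
  "g \<in> C_space X (int n) \<Longrightarrow> x \<in> X \<Longrightarrow> y \<in> X \<Longrightarrow> \<forall>i\<in>set (window n). x i = y i \<Longrightarrow> g x = g y"
  unfolding C_space_eq by blast

lemma C_space_mono: "m \<le> n \<Longrightarrow> C_space X (int m) \<subseteq> C_space X (int n)"
  using set_window_mono[of m n] unfolding C_space_eq by blast

lemma C_space_diff:
  assumes "g \<in> C_space X (int n)" "h \<in> C_space X (int n)"
  shows "(\<lambda>x. g x - h x) \<in> C_space X (int n)"
proof (rule C_spaceI)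
  fix x y assume "x \<in> X" "y \<in> X" "\<forall>i\<in>set (window n). x i = y i"
  then show "g x - h x = g y - h y" by (metis assms C_space_agree)
qed (simp add: C_space_outside[OF assms(1)] C_space_outside[OF assms(2)])

lemma C_space_mult:
  assumes "g \<in> C_space X (int n)" "h \<in> C_space X (int n)"
  shows "(\<lambda>x. g x * h x) \<in> C_space X (int n)"
proof (rule C_spaceI)
  fix x y assume "x \<in> X" "y \<in> X" "\<forall>i\<in>set (window n). x i = y i"
  then show "g x * h x = g y * h y" by (metis assms C_space_agree)
qed (simp add: C_space_outside[OF assms(1)])

lemma measurable_coordinate: "(\<lambda>x. x i) \<in> borel_measurable M"
proof -
  have "(\<lambda>x :: int \<Rightarrow> nat. x i) \<in> borel_measurable borel" by measurable
  then show ?thesis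
    by (simp add: measurable_cong_sets[OF sets_eq refl] measurable_restrict_space1)
qed

lemma cylinder_sets: "cylinder X w \<in> sets M"
proof -
  have "cylinder X w = {x \<in> space M. \<forall>i<length w. x (window (length w) ! i) = w ! i}"
    by (auto simp: cylinder_def space_eq list_eq_iff_nth_eq length_window)
  also have "\<dots> \<in> sets M"
    using measurable_coordinate by measurable
  finally show ?thesis .
qed

lemma C_space_measurable:
  assumes "g \<in> C_space X (int n)" shows "g \<in> borel_measurable M"
proof -
  have "X \<in> sets M" using sets.top[of M] by (simp add: space_eq)
  then show ?thesis
    using assms cylinder_sets by (auto simp: C_space_def split: if_splits)
qed

lemma C_space_bounded:
  assumes "g \<in> C_space X (int n)" shows "\<exists>B. \<forall>x. cmod (g x) \<le> B"
proof (cases "n = 0")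
  case True
  then obtain c where "g = (\<lambda>x. c * indicator X x)" using assms by (auto simp: C_space_def)
  then have "cmod (g x) \<le> cmod c" for x by (simp add: indicator_def)
  then show ?thesis by blast
next
  case False
  then obtain a where g: "g = (\<lambda>x. \<Sum>w\<in>words X n. a w * indicator (cylinder X w) x)"
    using assms by (auto simp: C_space_def)
  have "cmod (g x) \<le> (\<Sum>w\<in>words X n. cmod (a w))" for x
    unfolding g by (rule order_trans[OF norm_sum sum_mono]) (simp add: indicator_def)
  then show ?thesis by blast
qed

lemma C_space_L2:
  assumes "g \<in> C_space X (int n)" shows "g \<in> L2 M"
proof -
  obtain B where "\<forall>x. cmod (g x) \<le> B" using C_space_bounded[OF assms] by blast
  moreover have "(\<lambda>x. 1) \<in> L2 M" by (simp add: L2_def)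
  ultimately show ?thesis
    using L2_bounded_mult[OF C_space_measurable[OF assms], of B "\<lambda>x. 1"] by simp
qed

lemma C_space_pred: "0 < n \<Longrightarrow> C_space X (int n - 1) = C_space X (int (n - 1))"
  by (simp add: of_nat_diff)

lemma C_space_below:
  assumes "j < n" shows "C_space X (int j) \<subseteq> C_space X (int n - 1)"
proof -
  have "0 < n" "j \<le> n - 1" using assms by auto
  then show ?thesis unfolding C_space_pred[OF \<open>0 < n\<close>] by (intro C_space_mono)
qed

lemma eigenspace_C_space: "p \<in> eigenspace X M n \<Longrightarrow> p \<in> C_space X (int n)"
  by (simp add: eigenspace_def)

lemma eigenspace_L2: "p \<in> eigenspace X M n \<Longrightarrow> p \<in> L2 M"
  by (rule C_space_L2[OF eigenspace_C_space])

lemma eigenspace_orthogonal: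
  assumes "p \<in> eigenspace X M j" "g \<in> C_space X (int i)" "i < j"
  shows "l2_inner M p g = 0"
  using assms(1,2) C_space_below[OF assms(3)] by (auto simp: eigenspace_def)

lemma eigenspaces_orthogonal:
  assumes "p \<in> eigenspace X M i" "g \<in> eigenspace X M j" "i \<noteq> j"
  shows "l2_inner M p g = 0"
proof (cases "i < j")
  case True
  have "l2_inner M g p = 0"
    by (rule eigenspace_orthogonal[OF assms(2) eigenspace_C_space[OF assms(1)] True])
  then show ?thesis by (subst l2_inner_commute) simp
next
  case False
  then have "j < i" using assms(3) by simp
  then show ?thesis
    by (rule eigenspace_orthogonal[OF assms(1) eigenspace_C_space[OF assms(2)]])
qed

text \<open>
  The sequence of eigencomponents in the definition of the Dirac operator is only asserted to exist.
  This lemma determines it almost everywhere, since eigenspaces of different index are orthogonal.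
\<close>

lemma l2_inner_component:
  assumes p: "\<And>i. p i \<in> eigenspace X M i" and sums: "l2_sums M p \<xi>" and \<xi>: "\<xi> \<in> L2 M"
    and g: "g \<in> eigenspace X M j"
  shows "l2_inner M \<xi> g = l2_inner M (p j) g"
proof -
  have gL2: "g \<in> L2 M" using g by (rule eigenspace_L2)
  have pL2: "p i \<in> L2 M" for i using p by (rule eigenspace_L2)
  have le: "cmod (l2_inner M \<xi> g - l2_inner M (p j) g)
      \<le> l2_norm M (\<lambda>x. \<xi> x - (\<Sum>i<N. p i x)) * l2_norm M g" if "j < N" for N
  proof -
    have "(\<Sum>i<N. l2_inner M (p i) g) = (\<Sum>i<N. if i = j then l2_inner M (p j) g else 0)"
      using eigenspaces_orthogonal[OF p g] by (intro sum.cong) auto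
    also have "\<dots> = l2_inner M (p j) g" using that by simp
    finally have "l2_inner M (\<lambda>x. \<xi> x - (\<Sum>i<N. p i x)) g = l2_inner M \<xi> g - l2_inner M (p j) g"
      by (simp add: l2_inner_diff_left l2_inner_sum_left L2_sum \<xi> gL2 pL2)
    then show ?thesis
      using l2_inner_le[of "\<lambda>x. \<xi> x - (\<Sum>i<N. p i x)" M g] by (simp add: L2_diff L2_sum \<xi> gL2 pL2)
  qed
  have "(\<lambda>N. l2_norm M (\<lambda>x. \<xi> x - (\<Sum>i<N. p i x)) * l2_norm M g) \<longlonglongrightarrow> 0"
    using sums unfolding l2_sums_def by (rule tendsto_mult_left_zero)
  then have "cmod (l2_inner M \<xi> g - l2_inner M (p j) g) \<le> 0"
    using le by (intro tendsto_lowerbound[where F = sequentially])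
      (auto intro: eventually_sequentiallyI[of "Suc j"])
  then show ?thesis by simp
qed

lemma l2_inner_component_self:
  assumes "\<And>i. p i \<in> eigenspace X M i" "l2_sums M p \<xi>" "\<xi> \<in> L2 M"
  shows "l2_inner M \<xi> (p j) = of_real ((l2_norm M (p j))\<^sup>2)"
  using l2_inner_component[OF assms assms(1), of j] by (simp only: l2_inner_self)

lemma l2_norm_component_le:
  assumes "\<And>i. p i \<in> eigenspace X M i" "l2_sums M p \<xi>" "\<xi> \<in> L2 M"
  shows "l2_norm M (p j) \<le> l2_norm M \<xi>"
proof -
  have "(l2_norm M (p j))\<^sup>2 = cmod (l2_inner M \<xi> (p j))"
    unfolding l2_inner_component_self[OF assms] by (simp only: norm_of_real abs_power2)
  also have "\<dots> \<le> l2_norm M \<xi> * l2_norm M (p j)"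
    by (rule l2_inner_le[OF assms(3) eigenspace_L2[OF assms(1)]])
  finally show ?thesis
    using l2_norm_nonneg[of M \<xi>] l2_norm_nonneg[of M "p j"]
    by (cases "l2_norm M (p j) = 0") (auto simp: power2_eq_square)
qed

end

section \<open>Commutators with functions living on one cylinder\<close>

context subshift_measure
begin

text \<open>
  Point evaluation at a cylinder on which \<open>g\<close> is constant: the part of the integral of \<open>\<bar>g\<bar>\<^sup>2\<close>
  over \<open>I\<close> alone already gives the bound.
\<close>

lemma C_space_value_le:
  assumes g: "g \<in> C_space X (int n)" and I: "I \<in> sets M" "x \<in> I"
    and const: "\<And>y. y \<in> I \<Longrightarrow> g y = g x"
  shows "cmod (g x) * sqrt (prob I) \<le> l2_norm M g"
proof (rule power2_le_imp_le)
  have "(cmod (g x))\<^sup>2 * prob I = (LINT y|M. (cmod (g x))\<^sup>2 * indicator I y)"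
    using I(1) by (simp add: sets.Int_space_eq1)
  also have "\<dots> \<le> (LINT y|M. (cmod (g y))\<^sup>2)"
  proof (rule integral_mono)
    show "integrable M (\<lambda>y. (cmod (g y))\<^sup>2)"
      using C_space_L2[OF g] by (simp add: L2_def)
    show "integrable M (\<lambda>y. (cmod (g x))\<^sup>2 * indicator I y)"
      using I(1) by (simp add: emeasure_eq_measure)
    show "(cmod (g x))\<^sup>2 * indicator I y \<le> (cmod (g y))\<^sup>2" for y
      using const[of y] by (simp add: indicator_def)
  qed
  finally show "(cmod (g x) * sqrt (prob I))\<^sup>2 \<le> (l2_norm M g)\<^sup>2"
    by (simp add: power_mult_distrib l2_norm_power2)
qed (rule l2_norm_nonneg)

text \<open>
  Multiplication by a real \<open>f\<close> is symmetric and preserves the spaces \<open>C_space X i\<close> with \<open>i \<ge> n\<close>, hence also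
  their orthogonal differences. So \<open>f\<close> commutes with the Dirac operator on the higher eigenspaces.
\<close>

lemma eigenspace_mult:
  assumes "n < j" and f: "f \<in> C_space X (int n)" "\<And>x. cnj (f x) = f x"
    and g: "g \<in> eigenspace X M j"
  shows "(\<lambda>x. f x * g x) \<in> eigenspace X M j"
proof -
  have "0 < j" using assms(1) by simp
  have f': "f \<in> C_space X (int i)" if "n \<le> i" for i
    using C_space_mono[OF that] f(1) by blast
  have "l2_inner M (\<lambda>x. f x * g x) h = 0" if "h \<in> C_space X (int (j - 1))" for h
  proof -
    have "(\<lambda>x. f x * h x) \<in> C_space X (int (j - 1))"
      using assms(1) by (intro C_space_mult f' that) simp
    then have "l2_inner M g (\<lambda>x. f x * h x) = 0"
      by (rule eigenspace_orthogonal[OF g]) (use \<open>0 < j\<close> in simp)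
    then show ?thesis unfolding l2_inner_real_mult[OF f(2)] .
  qed
  moreover have "(\<lambda>x. f x * g x) \<in> C_space X (int j)"
    using assms(1) by (intro C_space_mult f' eigenspace_C_space[OF g]) simp
  ultimately show ?thesis
    unfolding eigenspace_def C_space_pred[OF \<open>0 < j\<close>] by blast
qed

lemma eigenspace_diff:
  assumes "g \<in> eigenspace X M j" "h \<in> eigenspace X M j"
  shows "(\<lambda>x. g x - h x) \<in> eigenspace X M j"
proof (cases "j = 0")
  case True
  then show ?thesis
    using C_space_diff[of g j h] assms by (simp add: eigenspace_def C_space_def l2_inner_def)
next
  case False
  then have "0 < j" by simp
  have "l2_inner M (\<lambda>x. g x - h x) k = 0" if "k \<in> C_space X (int (j - 1))" for k
  proof -
    have "l2_inner M g k = 0" "l2_inner M h k = 0"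
      using \<open>0 < j\<close> by (auto intro: eigenspace_orthogonal[OF assms(1) that] eigenspace_orthogonal[OF assms(2) that])
    then show ?thesis
      by (simp add: l2_inner_diff_left eigenspace_L2[OF assms(1)] eigenspace_L2[OF assms(2)] C_space_L2[OF that])
  qed
  moreover have "(\<lambda>x. g x - h x) \<in> C_space X (int j)"
    by (intro C_space_diff eigenspace_C_space assms)
  ultimately show ?thesis
    unfolding eigenspace_def C_space_pred[OF \<open>0 < j\<close>] by blast
qed

text \<open>
  Let \<open>p\<close> and \<open>p'\<close> be the components of \<open>\<xi>\<close> and \<open>f \<xi>\<close>, and \<open>d i = p' i - f p i\<close>. Above level \<open>n\<close>
  the \<open>d i\<close> vanish, because \<open>f\<close> preserves the higher eigenspaces. Hence \<open>\<Sum>i\<le>n. d i = 0\<close>, and the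
  commutator applied to \<open>\<xi>\<close> is \<open>\<Sum>i\<le>n. i * d i = - (\<Sum>i<n. (n - i) * d i)\<close>, in which the component of
  index \<open>n\<close> has disappeared. For \<open>i < n\<close> the function \<open>p i\<close> is constant on \<open>I\<close>, so \<open>f p i\<close> is a multiple
  of \<open>f\<close> by a number of modulus at most \<open>\<parallel>p i\<parallel> / sqrt (prob I)\<close>, of norm at most
  \<open>\<parallel>f\<parallel> / sqrt (prob I)\<close> if \<open>\<parallel>\<xi>\<parallel> \<le> 1\<close>; as \<open>f\<close> is symmetric, the same bound holds for \<open>p' i\<close>.
  Each of the \<open>n\<close> terms is estimated separately, which gives the square of \<open>n\<close>. Orthogonality of the
  terms would give \<open>n\<close>, but any fixed power serves for numbers \<open>\<theta>\<close> that are approximable well enough.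
\<close>

theorem commutator_norm_le:
  assumes n: "0 < n" and f: "f \<in> eigenspace X M n" and real: "\<And>x. cnj (f x) = f x"
    and I: "I \<in> sets M" "0 < prob I" and supp: "\<And>x. x \<notin> I \<Longrightarrow> f x = 0"
    and const: "\<And>g x y. g \<in> C_space X (int n - 1) \<Longrightarrow> x \<in> I \<Longrightarrow> y \<in> I \<Longrightarrow> g x = g y"
  shows "commutator_norm X M f \<le> ennreal (2 * (real n)\<^sup>2 * l2_norm M f / sqrt (prob I))"
proof -
  have fC: "f \<in> C_space X (int n)" and fmeas: "f \<in> borel_measurable M"
    using f eigenspace_C_space C_space_measurable by blast+
  obtain B where B: "cmod (f x) \<le> B" for x using C_space_bounded[OF fC] by blast
  obtain x0 where x0: "x0 \<in> I" using I(2) by (cases "I = {}") auto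
  define K where "K = l2_norm M f / sqrt (prob I)"
  have low: "(\<lambda>x. f x * g x) = (\<lambda>x. g x0 * f x)" "cmod (g x0) * l2_norm M f \<le> K * l2_norm M g"
    if g: "g \<in> eigenspace X M j" and "j < n" for g j
  proof -
    have gC: "g \<in> C_space X (int n - 1)"
      using C_space_below[OF that(2)] eigenspace_C_space[OF g] by blast
    show "(\<lambda>x. f x * g x) = (\<lambda>x. g x0 * f x)"
      using const[OF gC _ x0] supp by (metis mult.commute mult_zero_left)
    have "cmod (g x0) * sqrt (prob I) \<le> l2_norm M g"
      using C_space_value_le[OF eigenspace_C_space[OF g] I(1) x0] const[OF gC _ x0] by blast
    then have "cmod (g x0) \<le> l2_norm M g / sqrt (prob I)"
      using I(2) by (simp add: pos_le_divide_eq)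
    then have "cmod (g x0) * l2_norm M f \<le> l2_norm M g / sqrt (prob I) * l2_norm M f"
      by (rule mult_right_mono) (rule l2_norm_nonneg)
    then show "cmod (g x0) * l2_norm M f \<le> K * l2_norm M g"
      by (simp add: K_def mult.commute)
  qed
  have K: "0 \<le> K" by (simp add: K_def l2_norm_nonneg)
  have bound: "l2_norm M (\<lambda>x. \<zeta> x - f x * \<eta> x) \<le> 2 * (real n)\<^sup>2 * K"
    if \<xi>\<eta>: "(\<xi>, \<eta>) \<in> dirac_graph X M" and f\<xi>\<zeta>: "((\<lambda>x. f x * \<xi> x), \<zeta>) \<in> dirac_graph X M"
      and \<xi>1: "l2_norm M \<xi> \<le> 1" for \<xi> \<eta> \<zeta>
  proof -
    obtain p where \<xi>: "\<xi> \<in> L2 M" "\<eta> \<in> L2 M" and p: "\<And>i. p i \<in> eigenspace X M i"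
      and p\<xi>: "l2_sums M p \<xi>" and p\<eta>: "l2_sums M (\<lambda>i x. of_nat i * p i x) \<eta>"
      using \<xi>\<eta> unfolding dirac_graph_def by blast
    obtain p' where f\<xi>: "(\<lambda>x. f x * \<xi> x) \<in> L2 M" "\<zeta> \<in> L2 M" and p': "\<And>i. p' i \<in> eigenspace X M i"
      and p'\<xi>: "l2_sums M p' (\<lambda>x. f x * \<xi> x)" and p'\<zeta>: "l2_sums M (\<lambda>i x. of_nat i * p' i x) \<zeta>"
      using f\<xi>\<zeta> unfolding dirac_graph_def by blast
    have pL2: "p i \<in> L2 M" "p' i \<in> L2 M" for i using p p' by (auto intro: eigenspace_L2)
    have fpL2: "(\<lambda>x. f x * p i x) \<in> L2 M" for i by (rule L2_bounded_mult[OF fmeas B pL2(1)])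
    define d where "d i x = p' i x - f x * p i x" for i x
    have dL2: "d i \<in> L2 M" for i
      unfolding d_def by (rule L2_diff[OF pL2(2) fpL2])
    have high: "l2_norm M (d i) = 0" if "n < i" for i
    proof -
      \<comment> \<open>The element \<open>d i\<close> of the \<open>i\<close>-th eigenspace is orthogonal to that eigenspace, hence to itself.\<close>
      have dE: "d i \<in> eigenspace X M i"
        unfolding d_def by (intro eigenspace_diff p' eigenspace_mult[OF that fC real p])
      have "l2_inner M (p' i) (d i) = l2_inner M (\<lambda>x. f x * \<xi> x) (d i)"
        by (rule l2_inner_component[OF p' p'\<xi> f\<xi>(1) dE, symmetric])
      also have "\<dots> = l2_inner M \<xi> (\<lambda>x. f x * d i x)"
        by (rule l2_inner_real_mult[OF real])
      also have "\<dots> = l2_inner M (p i) (\<lambda>x. f x * d i x)"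
        by (rule l2_inner_component[OF p p\<xi> \<xi>(1) eigenspace_mult[OF that fC real dE]])
      also have "\<dots> = l2_inner M (\<lambda>x. f x * p i x) (d i)"
        by (rule l2_inner_real_mult[OF real, symmetric])
      finally have "l2_inner M (\<lambda>x. p' i x - f x * p i x) (d i) = 0"
        by (simp add: l2_inner_diff_left[OF pL2(2) fpL2 dL2])
      then have "l2_inner M (d i) (d i) = 0" by (simp only: d_def[abs_def])
      then show ?thesis by (simp add: l2_inner_self)
    qed
    have "l2_sums M d (\<lambda>x. f x * \<xi> x - f x * \<xi> x)"
      using l2_sums_combine[OF p'\<xi> p\<xi> f\<xi>(1) \<xi>(1) pL2 fmeas B] by (simp add: d_def[abs_def])
    then have total: "l2_norm M (\<lambda>x. \<Sum>i\<le>n. d i x) = 0"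
      using l2_sums_truncate[of M d "\<lambda>x. 0" n] dL2 high by (simp add: L2_zero l2_norm_minus)
    have id: "of_nat i * p' i x - f x * (of_nat i * p i x) = of_nat i * d i x" for i x
      by (simp add: d_def algebra_simps)
    have "l2_sums M (\<lambda>i x. of_nat i * d i x) (\<lambda>x. \<zeta> x - f x * \<eta> x)"
      using l2_sums_combine[OF p'\<zeta> p\<eta> f\<xi>(2) \<xi>(2) L2_cmult[OF pL2(1)] L2_cmult[OF pL2(2)] fmeas B]
      by (simp only: id)
    then have weighted: "l2_norm M (\<lambda>x. (\<zeta> x - f x * \<eta> x) - (\<Sum>i\<le>n. of_nat i * d i x)) = 0"
      using l2_sums_truncate[of M "\<lambda>i x. of_nat i * d i x" "\<lambda>x. \<zeta> x - f x * \<eta> x" n] dL2 high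
      by (simp add: L2_cmult L2_diff f\<xi> L2_bounded_mult[OF fmeas B \<xi>(2)] l2_norm_cmult)
    have le_K: "l2_norm M (d i) \<le> 2 * K" if "i < n" for i
    proof -
      have "l2_norm M (p i) \<le> 1"
        using l2_norm_component_le[OF p p\<xi> \<xi>(1), of i] \<xi>1 by simp
      then have "K * l2_norm M (p i) \<le> K"
        using mult_left_mono[OF _ K, of "l2_norm M (p i)" 1] by simp
      then have 1: "l2_norm M (\<lambda>x. f x * p i x) \<le> K"
        using low[OF p that] by (simp add: l2_norm_cmult)
      \<comment> \<open>The symmetry of \<open>f\<close> moves the estimate from \<open>p' i\<close> to \<open>f p' i\<close>, a multiple of \<open>f\<close>.\<close>
      have "complex_of_real ((l2_norm M (p' i))\<^sup>2) = l2_inner M \<xi> (\<lambda>x. f x * p' i x)"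
        using l2_inner_component_self[OF p' p'\<xi> f\<xi>(1), of i] by (simp add: l2_inner_real_mult[OF real])
      then have "(l2_norm M (p' i))\<^sup>2 = cmod (l2_inner M \<xi> (\<lambda>x. f x * p' i x))"
        by (metis abs_power2 norm_of_real)
      also have "\<dots> \<le> l2_norm M \<xi> * l2_norm M (\<lambda>x. f x * p' i x)"
        by (rule l2_inner_le[OF \<xi>(1) L2_bounded_mult[OF fmeas B pL2(2)]])
      also have "\<dots> \<le> 1 * (K * l2_norm M (p' i))"
        using low[OF p' that] \<xi>1 by (intro mult_mono) (auto simp: l2_norm_cmult l2_norm_nonneg)
      finally have "l2_norm M (p' i) \<le> K"
        using K l2_norm_nonneg[of M "p' i"]
        by (cases "l2_norm M (p' i) = 0") (auto simp: power2_eq_square)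
      then show ?thesis
        using 1 l2_norm_diff_le[OF pL2(2) fpL2, of i i] by (simp add: d_def[abs_def])
    qed
    let ?v = "\<lambda>x. \<zeta> x - f x * \<eta> x"
    let ?r = "\<lambda>x. ?v x - (\<Sum>i\<le>n. of_nat i * d i x)"
    let ?s = "\<lambda>x. of_nat n * (\<Sum>i\<le>n. d i x)"
    let ?t = "\<lambda>x. \<Sum>i<n. of_nat (n - i) * d i x"
    have "(\<Sum>i\<le>n. of_nat i * d i x) = ?s x - ?t x" for x
    proof -
      have "?s x - (\<Sum>i\<le>n. of_nat i * d i x) = (\<Sum>i\<le>n. of_nat (n - i) * d i x)"
        unfolding sum_distrib_left sum_subtractf[symmetric]
        by (rule sum.cong) (auto simp: of_nat_diff algebra_simps)
      also have "\<dots> = ?t x" by (simp add: lessThan_Suc_atMost[symmetric])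
      finally show ?thesis by (simp add: algebra_simps)
    qed
    then have "?v = (\<lambda>x. (?r x + ?s x) - ?t x)" by (simp add: fun_eq_iff)
    moreover have vL2: "?v \<in> L2 M"
      by (intro L2_diff f\<xi> L2_bounded_mult[OF fmeas B \<xi>(2)])
    have rL2: "?r \<in> L2 M" by (intro L2_diff[OF vL2] L2_sum L2_cmult dL2)
    have sL2: "?s \<in> L2 M" by (intro L2_sum L2_cmult dL2)
    have tL2: "?t \<in> L2 M" by (intro L2_sum L2_cmult dL2)
    ultimately have "l2_norm M ?v \<le> l2_norm M ?r + l2_norm M ?s + l2_norm M ?t"
      using l2_norm_diff_le[OF L2_add[OF rL2 sL2] tL2] l2_norm_triangle[OF rL2 sL2] by simp
    also have "\<dots> = l2_norm M ?t"
      using weighted total by (simp add: l2_norm_cmult)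
    also have "\<dots> \<le> (\<Sum>i<n. real (n - i) * l2_norm M (d i))"
      using l2_norm_sum_le[of "{..<n}" "\<lambda>i x. of_nat (n - i) * d i x" M] dL2
      by (simp add: L2_cmult l2_norm_cmult del: of_nat_diff)
    also have "\<dots> \<le> (\<Sum>i<n. real n * (2 * K))"
      using le_K by (intro sum_mono mult_mono) (auto simp: l2_norm_nonneg)
    also have "\<dots> = 2 * (real n)\<^sup>2 * K" by (simp add: power2_eq_square)
    finally show ?thesis .
  qed
  then have "commutator_norm X M f \<le> ennreal (2 * (real n)\<^sup>2 * K)"
    unfolding commutator_norm_def by (intro SUP_least) (auto intro!: ennreal_leI)
  then show ?thesis by (simp add: K_def)
qed

lemma mem_cylinder_iff:
  "x \<in> cylinder X (map w (window n)) \<longleftrightarrow> x \<in> X \<and> (\<forall>i\<in>set (window n). x i = w i)"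
  by (auto simp: cylinder_def length_window)

text \<open>
  The test function of a cut: a multiple of \<open>indicator J / a - indicator (I - J) / b\<close>, where \<open>a\<close> and \<open>b\<close>
  are the measures of the two pieces. Its mean is \<open>0\<close> and functions of the smaller window are constant
  on \<open>I\<close>, so it is orthogonal to them. Off \<open>J\<close> its values are nonpositive, so that at any point outside
  \<open>J\<close> it differs from its value at \<open>w\<close> by at least the latter.
\<close>

theorem haar_function:
  fixes w :: "int \<Rightarrow> nat" and n :: nat
  defines "I \<equiv> cylinder X (map w (window (n - 1)))" and "J \<equiv> cylinder X (map w (window n))"
  assumes n: "0 < n" and w: "w \<in> X" and J: "0 < prob J" and K: "prob J < prob I"
  obtains f where "f \<in> C_inf X" "commutator_norm X M f \<le> 1"
    and "f w = of_real (sqrt ((prob I - prob J) / prob J) / (2 * (real n)\<^sup>2))"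
    and "\<And>x. x \<notin> J \<Longrightarrow> \<exists>r\<le>0. f x = of_real r"
proof -
  define a b where "a = prob J" and "b = prob I - prob J"
  have ab: "0 < a" "0 < b" "prob I = a + b" using J K by (simp_all add: a_def b_def)
  \<comment> \<open>The factor that turns the bound of \<open>commutator_norm_le\<close> into \<open>1\<close>.\<close>
  define t where "t = sqrt (a * b) / (2 * (real n)\<^sup>2)"
  have t: "0 < t" using ab n by (simp add: t_def)
  have sets: "I \<in> events" "J \<in> events" by (simp_all add: I_def J_def cylinder_sets)
  have sub: "set (window (n - 1)) \<subseteq> set (window n)" by (rule set_window_mono) simp
  have JI: "J \<subseteq> I" using sub unfolding I_def J_def mem_cylinder_iff subset_iff by blast
  have IX: "I \<subseteq> X" unfolding I_def by (auto simp: mem_cylinder_iff)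
  have wJ: "w \<in> J" unfolding J_def using w by (simp add: mem_cylinder_iff)
  define h :: "(int \<Rightarrow> nat) \<Rightarrow> real"
    where "h x = t / a * indicator J x - t / b * (indicator I x - indicator J x)" for x
  have hJ: "h x = t / a" if "x \<in> J" for x using that JI by (auto simp: h_def indicator_def)
  have hI: "h x = - t / b" if "x \<in> I" "x \<notin> J" for x using that by (simp add: h_def)
  have h0: "h x = 0" if "x \<notin> I" for x using that JI by (auto simp: h_def indicator_def)
  define f where "f x = complex_of_real (h x)" for x
  have fC: "f \<in> C_space X (int n)"
  proof (rule C_spaceI)
    show "f x = 0" if "x \<notin> X" for x using that IX h0[of x] by (auto simp: f_def)
    fix x y assume "x \<in> X" "y \<in> X" "\<forall>i\<in>set (window n). x i = y i"
    then have "(x \<in> J) = (y \<in> J)" "(x \<in> I) = (y \<in> I)"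
      using sub unfolding I_def J_def mem_cylinder_iff by (metis, metis subsetD)
    then show "f x = f y" by (simp add: f_def h_def indicator_def)
  qed
  have const: "g x = g y" if "g \<in> C_space X (int n - 1)" "x \<in> I" "y \<in> I" for g x y
  proof -
    have "g \<in> C_space X (int (n - 1))" using that(1) unfolding C_space_pred[OF n] .
    then show ?thesis
      by (rule C_space_agree) (use that(2,3) in \<open>auto simp: I_def mem_cylinder_iff\<close>)
  qed
  have indJ: "integrable M (indicator J :: _ \<Rightarrow> real)" and indI: "integrable M (indicator I :: _ \<Rightarrow> real)"
    using sets by (simp_all add: emeasure_eq_measure)
  have "(LINT x|M. h x) = t / a * prob J - t / b * (prob I - prob J)"
    unfolding h_def using sets indI indJ by simp
  then have mean: "(LINT x|M. h x) = 0" using ab(1,2) by (simp add: a_def b_def)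
  have orth: "l2_inner M f g = 0" if g: "g \<in> C_space X (int n - 1)" for g
  proof -
    have "f x * cnj (g x) = complex_of_real (h x) * cnj (g w)" for x
      using const[OF g, of x w] h0[of x] JI wJ by (cases "x \<in> I") (auto simp: f_def)
    then show ?thesis by (simp add: l2_inner_def mean)
  qed
  have f: "f \<in> eigenspace X M n" using fC orth by (simp add: eigenspace_def)
  have "(l2_norm M f)\<^sup>2 = (LINT x|M. (t / a)\<^sup>2 * indicator J x + (t / b)\<^sup>2 * (indicator I x - indicator J x))"
    unfolding l2_norm_power2
  proof (rule Bochner_Integration.integral_cong[OF refl])
    fix x
    have "(cmod (f x))\<^sup>2 = (h x)\<^sup>2" by (simp add: f_def)
    also have "\<dots> = (t / a)\<^sup>2 * indicator J x + (t / b)\<^sup>2 * (indicator I x - indicator J x)"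
      using JI hJ[of x] hI[of x] h0[of x] by (cases "x \<in> J"; cases "x \<in> I") auto
    finally show "(cmod (f x))\<^sup>2 = (t / a)\<^sup>2 * indicator J x + (t / b)\<^sup>2 * (indicator I x - indicator J x)" .
  qed
  also have "\<dots> = (t / a)\<^sup>2 * prob J + (t / b)\<^sup>2 * (prob I - prob J)"
    using sets indI indJ by simp
  also have "\<dots> = (t / a)\<^sup>2 * a + (t / b)\<^sup>2 * b" by (simp add: a_def b_def)
  also have "\<dots> = t\<^sup>2 * (a + b) / (a * b)"
    using ab by (simp add: field_simps power2_eq_square)
  finally have "l2_norm M f = sqrt (t\<^sup>2 * (a + b) / (a * b))"
    by (metis l2_norm_nonneg real_sqrt_unique)
  then have "l2_norm M f / sqrt (prob I) = t / sqrt (a * b)"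
    using ab t by (simp add: real_sqrt_divide real_sqrt_mult)
  also have "\<dots> = 1 / (2 * (real n)\<^sup>2)"
    using ab by (simp add: t_def)
  finally have "2 * (real n)\<^sup>2 * l2_norm M f / sqrt (prob I) = 1"
    using n by (simp only: times_divide_eq_right[symmetric]) simp
  moreover have "commutator_norm X M f \<le> ennreal (2 * (real n)\<^sup>2 * l2_norm M f / sqrt (prob I))"
    by (rule commutator_norm_le[OF n f _ sets(1) _ _ const]) (use ab h0 in \<open>auto simp: f_def\<close>)
  ultimately have "commutator_norm X M f \<le> 1" by (simp only: ennreal_1)
  moreover have "f \<in> C_inf X" using fC unfolding C_inf_def by blast
  moreover have "f w = of_real (sqrt (b / a) / (2 * (real n)\<^sup>2))"
  proof -
    have "sqrt (a * b) / a = sqrt (b / a)"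
    proof -
      have "b / a = (a * b) / a\<^sup>2" using ab by (simp add: power2_eq_square)
      then show ?thesis using ab by (simp only: real_sqrt_divide real_sqrt_abs abs_of_pos)
    qed
    moreover have "t / a = (sqrt (a * b) / a) / (2 * (real n)\<^sup>2)" by (simp add: t_def mult.commute)
    ultimately have "t / a = sqrt (b / a) / (2 * (real n)\<^sup>2)" by (simp only:)
    then show ?thesis using hJ[OF wJ] by (simp add: f_def)
  qed
  moreover have "\<exists>r\<le>0. f x = of_real r" if "x \<notin> J" for x
  proof -
    have "h x \<le> 0" using that hI[of x] h0[of x] t ab by (cases "x \<in> I") auto
    then show ?thesis by (auto simp: f_def)
  qed
  ultimately show thesis using that by (simp add: a_def b_def)
qed

end

section \<open>Heights of Sturmian sequences\<close>

lemma sturmian_translate: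
  assumes "w \<in> sturmian \<theta>" shows "(\<lambda>i. w (i + c)) \<in> sturmian \<theta>"
proof -
  obtain x I where I: "I \<in> {{0..<1 - \<theta>}, {0<..1 - \<theta>}}"
    and w: "\<And>n. w n = (if frac (of_int n * \<theta> - x) \<in> I then 0 else 1)"
    using assms unfolding sturmian_def by blast
  have "of_int (n + c) * \<theta> - x = of_int n * \<theta> - (x - of_int c * \<theta>)" for n
    by (simp add: algebra_simps)
  then have "\<forall>n. w (n + c) = (if frac (of_int n * \<theta> - (x - of_int c * \<theta>)) \<in> I then 0 else 1)"
    by (simp only: w) simp
  then show ?thesis
    using I unfolding sturmian_def by blast
qed

text \<open>
  The number of ones at the places from \<open>0\<close> to \<open>k - 1\<close>, continued additively to negative \<open>k\<close>.
\<close>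

definition height :: "(int \<Rightarrow> nat) \<Rightarrow> int \<Rightarrow> int" where
  "height w k = (\<Sum>j\<in>{0..<k}. int (w j)) - (\<Sum>j\<in>{k..<0}. int (w j))"

lemma height_0: "height w 0 = 0"
  by (simp add: height_def)

lemma height_step: "height w (k + 1) = height w k + int (w k)"
proof (cases "0 \<le> k")
  case True
  then have "{0..<k + 1} = insert k {0..<k}" by auto
  then show ?thesis using True by (simp add: height_def)
next
  case False
  then have "{k..<0} = insert k {k + 1..<0}" by auto
  then show ?thesis using False by (simp add: height_def)
qed

lemma height_unique:
  assumes "G 0 = 0" "\<And>k. G (k + 1) = G k + int (w k)"
  shows "height w k = G k"
proof (induction k rule: int_induct[of _ 0])
  case base
  then show ?case by (simp add: height_0 assms(1))
next
  case (step1 i)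
  then show ?case by (simp add: height_step assms(2))
next
  case (step2 i)
  then show ?case using height_step[of w "i - 1"] assms(2)[of "i - 1"] by simp
qed

lemma height_agree_iff:
  assumes "a \<le> 0" "-1 \<le> b"
  shows "(\<forall>i\<in>{a..b}. w i = v i) \<longleftrightarrow> (\<forall>k\<in>{a..b + 1}. height w k = height v k)"
proof
  assume "\<forall>i\<in>{a..b}. w i = v i"
  then show "\<forall>k\<in>{a..b + 1}. height w k = height v k"
    using assms unfolding height_def by (intro ballI arg_cong2[where f = "(-)"] sum.cong) auto
next
  assume *: "\<forall>k\<in>{a..b + 1}. height w k = height v k"
  show "\<forall>i\<in>{a..b}. w i = v i"
  proof
    fix i assume "i \<in> {a..b}"
    then have "height w i = height v i" "height w (i + 1) = height v (i + 1)"
      using * by auto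
    then show "w i = v i" by (simp add: height_step)
  qed
qed

lemma floor_add_step:
  fixes z \<theta> :: real
  assumes "0 < \<theta>" "\<theta> < 1"
  shows "\<lfloor>z + \<theta>\<rfloor> = \<lfloor>z\<rfloor> + (if frac z \<in> {0..<1 - \<theta>} then 0 else 1)"
proof -
  have "real_of_int \<lfloor>z\<rfloor> \<le> z" "z < real_of_int \<lfloor>z\<rfloor> + 1" by linarith+
  then show ?thesis
    using assms by (auto simp: frac_def floor_eq_iff) linarith+
qed

lemma ceiling_add_step:
  fixes z \<theta> :: real
  assumes "0 < \<theta>" "\<theta> < 1"
  shows "\<lceil>z + \<theta>\<rceil> = \<lceil>z\<rceil> + (if frac z \<in> {0<..1 - \<theta>} then 0 else 1)"
proof -
  have z: "z = of_int \<lfloor>z\<rfloor> + frac z" "0 \<le> frac z" "frac z < 1"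
    by (simp_all add: frac_def frac_lt_1[unfolded frac_def])
  define m f where "m = \<lfloor>z\<rfloor>" and "f = frac z"
  have zz: "z = of_int m + f" and f: "0 \<le> f" "f < 1" using z by (simp_all add: m_def f_def)
  have f': "frac (of_int m + f) = f" using zz f_def by simp
  consider "f = 0" | "0 < f" "f \<le> 1 - \<theta>" | "1 - \<theta> < f" using f by linarith
  then show ?thesis
  proof cases
    case 1
    have "\<lceil>z + \<theta>\<rceil> = m + 1" "\<lceil>z\<rceil> = m" using assms by (auto simp: ceiling_eq_iff zz 1)
    then show ?thesis using 1 by (simp add: f_def)
  next
    case 2
    have "\<lceil>z + \<theta>\<rceil> = m + 1" "\<lceil>z\<rceil> = m + 1" using assms 2 f by (auto simp: ceiling_eq_iff zz)
    then show ?thesis using 2 by (simp add: f_def)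
  next
    case 3
    have "\<lceil>z + \<theta>\<rceil> = m + 2" "\<lceil>z\<rceil> = m + 1" using assms 3 f by (auto simp: ceiling_eq_iff zz)
    then show ?thesis using 3 by (simp add: f_def)
  qed
qed

text \<open>
  The letters of a Sturmian sequence are the increments of \<open>\<lfloor>k * \<theta> + y\<rfloor>\<close> or of \<open>\<lceil>k * \<theta> + y\<rceil>\<close>,
  according to the half-open interval that codes it. The two cases differ on the orbits that hit an end
  point of the interval.
\<close>

lemma sturmian_height:
  assumes "0 < \<theta>" "\<theta> < 1" "w \<in> sturmian \<theta>"
  obtains y where "0 \<le> y" "y < 1" "\<And>k. height w k = \<lfloor>of_int k * \<theta> + y\<rfloor>"
  | y where "0 < y" "y \<le> 1" "\<And>k. height w k = \<lceil>of_int k * \<theta> + y\<rceil> - 1"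
proof -
  obtain x I where I: "I \<in> {{0..<1 - \<theta>}, {0<..1 - \<theta>}}"
    and w: "\<And>n. w n = (if frac (of_int n * \<theta> - x) \<in> I then 0 else 1)"
    using assms unfolding sturmian_def by blast
  have step: "of_int (k + 1) * \<theta> - x = (of_int k * \<theta> - x) + \<theta>" for k
    by (simp add: algebra_simps)
  consider "I = {0..<1 - \<theta>}" | "I = {0<..1 - \<theta>}" using I by blast
  then show thesis
  proof cases
    case 1
    have "height w k = \<lfloor>of_int k * \<theta> - x\<rfloor> - \<lfloor>- x\<rfloor>" for k
    proof (rule height_unique)
      show "\<lfloor>of_int (k + 1) * \<theta> - x\<rfloor> - \<lfloor>- x\<rfloor> = \<lfloor>of_int k * \<theta> - x\<rfloor> - \<lfloor>- x\<rfloor> + int (w k)" for k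
        unfolding step floor_add_step[OF assms(1,2)] by (simp add: w 1)
    qed simp
    moreover have "of_int k * \<theta> + frac (- x) = of_int k * \<theta> - x - of_int \<lfloor>- x\<rfloor>" for k
      by (simp add: frac_def)
    ultimately have "height w k = \<lfloor>of_int k * \<theta> + frac (- x)\<rfloor>" for k
      by (simp only: floor_diff_of_int)
    then show thesis using that(1)[OF frac_ge_0 frac_lt_1] by blast
  next
    case 2
    have "height w k = \<lceil>of_int k * \<theta> - x\<rceil> - \<lceil>- x\<rceil>" for k
    proof (rule height_unique)
      show "\<lceil>of_int (k + 1) * \<theta> - x\<rceil> - \<lceil>- x\<rceil> = \<lceil>of_int k * \<theta> - x\<rceil> - \<lceil>- x\<rceil> + int (w k)" for k
        unfolding step ceiling_add_step[OF assms(1,2)] by (simp add: w 2)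
    qed simp
    moreover have "of_int k * \<theta> + (- x - of_int (\<lceil>- x\<rceil> - 1)) = of_int k * \<theta> - x - of_int (\<lceil>- x\<rceil> - 1)" for k
      by simp
    ultimately have "height w k = \<lceil>of_int k * \<theta> + (- x - of_int (\<lceil>- x\<rceil> - 1))\<rceil> - 1" for k
      by (simp only: ceiling_diff_of_int)
    moreover have "0 < - x - of_int (\<lceil>- x\<rceil> - 1)" "- x - of_int (\<lceil>- x\<rceil> - 1) \<le> 1"
      by linarith+
    ultimately show thesis using that(2) by blast
  qed
qed

text \<open>
  In terms of the point \<open>y\<close> of the circle that codes a sequence, this is the set where \<open>y\<close> has not yet
  passed \<open>1 - frac (k * \<theta>)\<close>, that is, an arc starting at \<open>0\<close>.
\<close>

definition lower :: "real \<Rightarrow> int \<Rightarrow> (int \<Rightarrow> nat) set" where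
  "lower \<theta> k = {w \<in> sturmian \<theta>. height w k = \<lfloor>of_int k * \<theta>\<rfloor>}"

lemma height_cases:
  assumes "0 < \<theta>" "\<theta> < 1" "w \<in> sturmian \<theta>"
  shows "height w k = \<lfloor>of_int k * \<theta>\<rfloor> \<or> height w k = \<lfloor>of_int k * \<theta>\<rfloor> + 1"
proof (rule sturmian_height[OF assms])
  fix y assume "0 \<le> y" "y < 1" "\<And>k. height w k = \<lfloor>of_int k * \<theta> + y\<rfloor>"
  then show ?thesis by (simp only:) linarith
next
  fix y assume "0 < y" "y \<le> 1" "\<And>k. height w k = \<lceil>of_int k * \<theta> + y\<rceil> - 1"
  then show ?thesis by (simp only:) linarith
qed

lemma height_near:
  assumes "0 < \<theta>" "\<theta> < 1" "w \<in> sturmian \<theta>"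
  shows "\<bar>of_int (height w k) - of_int k * \<theta>\<bar> \<le> 1"
  using height_cases[OF assms, of k] by linarith

text \<open>
  Arcs that start at \<open>0\<close> are nested according to their lengths. Both ways of coding have to be checked, as they
  differ at the right end point of the arc.
\<close>

lemma lower_mono:
  assumes \<theta>: "0 < \<theta>" "\<theta> < 1" and le: "frac (of_int l * \<theta>) \<le> frac (of_int k * \<theta>)"
  shows "lower \<theta> k \<subseteq> lower \<theta> l"
proof
  fix w assume "w \<in> lower \<theta> k"
  then have w: "w \<in> sturmian \<theta>" and k: "height w k = \<lfloor>of_int k * \<theta>\<rfloor>" by (auto simp: lower_def)
  have "height w l = \<lfloor>of_int l * \<theta>\<rfloor>"
  proof (rule sturmian_height[OF \<theta> w])
    fix y assume y: "0 \<le> y" "y < 1" "\<And>k. height w k = \<lfloor>of_int k * \<theta> + y\<rfloor>"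
    then have "frac (of_int k * \<theta>) + y < 1" using k unfolding frac_def by (simp add: floor_eq_iff)
    then have "frac (of_int l * \<theta>) + y < 1" using le by linarith
    then show ?thesis using y unfolding frac_def by (simp add: floor_eq_iff) linarith
  next
    fix y assume y: "0 < y" "y \<le> 1" "\<And>k. height w k = \<lceil>of_int k * \<theta> + y\<rceil> - 1"
    then have "\<lceil>of_int k * \<theta> + y\<rceil> = \<lfloor>of_int k * \<theta>\<rfloor> + 1" using k by simp
    then have "frac (of_int k * \<theta>) + y \<le> 1" unfolding frac_def by linarith
    then have "frac (of_int l * \<theta>) + y \<le> 1" using le by linarith
    then have "\<lceil>of_int l * \<theta> + y\<rceil> = \<lfloor>of_int l * \<theta>\<rfloor> + 1" using y unfolding frac_def by linarith
    then show ?thesis using y by simp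
  qed
  then show "w \<in> lower \<theta> l" using w by (simp add: lower_def)
qed

text \<open>
  The itinerary of the point \<open>y\<close> of the circle.
\<close>

definition coding :: "real \<Rightarrow> real \<Rightarrow> int \<Rightarrow> nat" where
  "coding \<theta> y = (\<lambda>i. nat (\<lfloor>of_int (i + 1) * \<theta> + y\<rfloor> - \<lfloor>of_int i * \<theta> + y\<rfloor>))"

lemma coding_step:
  fixes \<theta> y :: real
  assumes "0 < \<theta>" "\<theta> < 1"
  shows "\<lfloor>of_int (i + 1) * \<theta> + y\<rfloor>
    = \<lfloor>of_int i * \<theta> + y\<rfloor> + (if frac (of_int i * \<theta> + y) \<in> {0..<1 - \<theta>} then 0 else 1)"
  using floor_add_step[OF assms, of "of_int i * \<theta> + y"] by (simp add: algebra_simps)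

lemma coding_in_sturmian:
  assumes "0 < \<theta>" "\<theta> < 1" shows "coding \<theta> y \<in> sturmian \<theta>"
proof -
  have "\<forall>n. coding \<theta> y n = (if frac (of_int n * \<theta> - (- y)) \<in> {0..<1 - \<theta>} then 0 else 1)"
    unfolding coding_def coding_step[OF assms] by simp
  then show ?thesis unfolding sturmian_def by blast
qed

lemma height_coding:
  assumes "0 < \<theta>" "\<theta> < 1"
  shows "height (coding \<theta> y) k = \<lfloor>of_int k * \<theta> + y\<rfloor> - \<lfloor>y\<rfloor>"
proof (rule height_unique)
  show "\<lfloor>of_int (k + 1) * \<theta> + y\<rfloor> - \<lfloor>y\<rfloor> = \<lfloor>of_int k * \<theta> + y\<rfloor> - \<lfloor>y\<rfloor> + int (coding \<theta> y k)" for k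
    unfolding coding_def coding_step[OF assms] by simp
qed simp

section \<open>The unique invariant measure\<close>

lemma shift_measurable:
  "shift \<in> measurable (restrict_space borel (sturmian \<theta>)) (restrict_space borel (sturmian \<theta>))"
proof (rule measurable_restrict_space3)
  have "continuous_on UNIV shift"
    unfolding shift_def by (intro continuous_on_coordinatewise_then_product continuous_on_product_coordinates)
  then show "shift \<in> borel_measurable borel" by (rule borel_measurable_continuous_onI)
  show "shift \<in> sturmian \<theta> \<rightarrow> sturmian \<theta>"
    using sturmian_translate[of _ \<theta> 1] by (auto simp: shift_def)
qed

lemma sturmian_coordinate_measurable: "(\<lambda>w. real (w i)) \<in> borel_measurable (restrict_space borel (sturmian \<theta>))"
proof -
  have "(\<lambda>w :: int \<Rightarrow> nat. real (w i)) \<in> borel_measurable borel"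
    by (rule borel_measurable_continuous_onI[OF continuous_on_of_nat[OF continuous_on_product_coordinates]])
  then show ?thesis by (rule measurable_restrict_space1)
qed

lemma height_measurable: "(\<lambda>w. real_of_int (height w k)) \<in> borel_measurable (restrict_space borel (sturmian \<theta>))"
  unfolding height_def of_int_diff of_int_sum of_int_of_nat_eq
  by (intro borel_measurable_diff borel_measurable_sum sturmian_coordinate_measurable)

lemma lower_sets: "lower \<theta> k \<in> sets (restrict_space borel (sturmian \<theta>))"
proof -
  have "lower \<theta> k = {w \<in> space (restrict_space borel (sturmian \<theta>)).
      real_of_int (height w k) = real_of_int \<lfloor>of_int k * \<theta>\<rfloor>}"
    by (auto simp: lower_def space_restrict_space)
  also have "\<dots> \<in> sets (restrict_space borel (sturmian \<theta>))"
    using height_measurable by measurable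
  finally show ?thesis .
qed

lemma sturmian_le_1: "w \<in> sturmian \<theta> \<Longrightarrow> w i \<le> 1"
  unfolding sturmian_def mem_Collect_eq by (elim exE bexE) (simp del: insert_iff)

text \<open>
  By invariance the mean of the height is linear in \<open>k\<close>, and by \<open>height_near\<close> it stays within
  distance \<open>1\<close> of \<open>k * \<theta>\<close>. A linear function at bounded distance from another one has the same slope.
\<close>

lemma integral_height:
  assumes \<theta>: "0 < \<theta>" "\<theta> < 1" and inv: "invariant_probability (sturmian \<theta>) M"
  shows "(LINT w|M. real_of_int (height w k)) = of_int k * \<theta>"
proof -
  have sets: "sets M = sets (restrict_space borel (sturmian \<theta>))" and distr: "distr M M shift = M"
    using inv by (auto simp: invariant_probability_def)
  interpret prob_space M using inv by (simp add: invariant_probability_def)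
  have space: "space M = sturmian \<theta>"
    using sets_eq_imp_space_eq[OF sets] by (simp add: space_restrict_space)
  have meas: "(\<lambda>w. real (w i)) \<in> borel_measurable M" for i
    using sturmian_coordinate_measurable by (simp add: measurable_cong_sets[OF sets refl])
  have int: "integrable M (\<lambda>w. real (w i))" for i
    by (rule integrable_const_bound[where B = 1])
       (use sturmian_le_1[of _ \<theta> i] in \<open>auto simp: space intro!: AE_I2 meas\<close>)
  have step: "(LINT w|M. real (w (i + 1))) = (LINT w|M. real (w i))" for i
  proof -
    have "(LINT w|M. real (w i)) = (LINT w|distr M M shift. real (w i))" by (simp add: distr)
    also have "\<dots> = (LINT w|M. real (shift w i))"
      by (rule integral_distr) (use shift_measurable in \<open>simp add: measurable_cong_sets[OF sets sets]\<close>, rule meas)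
    finally show ?thesis by (simp add: shift_def)
  qed
  define \<alpha> where "\<alpha> = (LINT w|M. real (w 0))"
  have coord: "(LINT w|M. real (w i)) = \<alpha>" for i
  proof (induction i rule: int_induct[of _ 0])
    case (step2 i)
    then show ?case using step[of "i - 1"] by simp
  qed (simp_all add: \<alpha>_def step)
  have height_sum: "real_of_int (height w k) = (\<Sum>j\<in>{0..<k}. real (w j)) - (\<Sum>j\<in>{k..<0}. real (w j))" for w k
    by (simp add: height_def)
  have int_height: "integrable M (\<lambda>w. real_of_int (height w k))" for k
    unfolding height_sum by (intro Bochner_Integration.integrable_diff Bochner_Integration.integrable_sum int)
  have mean: "(LINT w|M. real_of_int (height w k)) = of_int k * \<alpha>" for k
  proof -
    have "(LINT w|M. real_of_int (height w k)) = (\<Sum>j\<in>{0..<k}. \<alpha>) - (\<Sum>j\<in>{k..<0}. \<alpha>)"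
      unfolding height_sum using int by (simp add: coord)
    also have "\<dots> = of_int k * \<alpha>" by (cases "0 \<le> k") auto
    finally show ?thesis .
  qed
  have close: "\<bar>of_int k * (\<alpha> - \<theta>)\<bar> \<le> 1" for k
  proof -
    have "of_int k * (\<alpha> - \<theta>) = (LINT w|M. real_of_int (height w k) - of_int k * \<theta>)"
      using int_height by (simp add: mean prob_space algebra_simps)
    also have "\<bar>\<dots>\<bar> \<le> (LINT w|M. \<bar>real_of_int (height w k) - of_int k * \<theta>\<bar>)"
      by (rule integral_abs_bound)
    also have "\<dots> \<le> (LINT w|M. 1)"
      using int_height height_near[OF \<theta>] by (intro integral_mono) (auto simp: space)
    finally show ?thesis by (simp add: prob_space)
  qed
  have "\<alpha> = \<theta>"
  proof (rule ccontr)
    assume "\<alpha> \<noteq> \<theta>"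
    then obtain n :: nat where "1 < real n * \<bar>\<alpha> - \<theta>\<bar>"
      using reals_Archimedean3[of "\<bar>\<alpha> - \<theta>\<bar>"] by auto
    then show False using close[of "int n"] by (simp add: abs_mult)
  qed
  then show ?thesis using mean by simp
qed

text \<open>
  On the subshift the height at \<open>k\<close> is \<open>\<lfloor>k * \<theta>\<rfloor> + 1\<close> minus the indicator of this set, so its mean
  determines the measure of the set.
\<close>

lemma measure_lower:
  assumes \<theta>: "0 < \<theta>" "\<theta> < 1" and inv: "invariant_probability (sturmian \<theta>) M"
  shows "measure M (lower \<theta> k) = 1 - frac (of_int k * \<theta>)"
proof -
  have sets: "sets M = sets (restrict_space borel (sturmian \<theta>))"
    using inv by (auto simp: invariant_probability_def)
  interpret prob_space M using inv by (simp add: invariant_probability_def)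
  have space: "space M = sturmian \<theta>"
    using sets_eq_imp_space_eq[OF sets] by (simp add: space_restrict_space)
  have L: "lower \<theta> k \<in> events" using lower_sets sets by simp
  have "of_int k * \<theta> = (LINT w|M. real_of_int (height w k))"
    by (rule integral_height[OF assms, symmetric])
  also have "\<dots> = (LINT w|M. (of_int \<lfloor>of_int k * \<theta>\<rfloor> + 1) - indicator (lower \<theta> k) w)"
  proof (intro Bochner_Integration.integral_cong refl)
    fix w assume "w \<in> space M"
    then show "real_of_int (height w k) = (of_int \<lfloor>of_int k * \<theta>\<rfloor> + 1) - indicator (lower \<theta> k) w"
      using height_cases[OF \<theta>, of w k] by (auto simp: space lower_def indicator_def)
  qed
  also have "\<dots> = of_int \<lfloor>of_int k * \<theta>\<rfloor> + 1 - prob (lower \<theta> k)"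
    using L by (simp add: emeasure_eq_measure prob_space)
  finally show ?thesis by (simp add: frac_def)
qed

lemma lower_0: "lower \<theta> 0 = sturmian \<theta>"
  by (simp add: lower_def height_0)

text \<open>
  The coordinates are increments of heights, and the height at \<open>k\<close> takes just two values, told apart by
  \<open>lower \<theta> k\<close>.
\<close>

lemma sets_sturmian_eq:
  assumes \<theta>: "0 < \<theta>" "\<theta> < 1"
  shows "sets (restrict_space borel (sturmian \<theta>)) = sigma_sets (sturmian \<theta>) (range (lower \<theta>))"
    (is "sets ?R = _")
proof
  have sub: "range (lower \<theta>) \<subseteq> Pow (sturmian \<theta>)" by (auto simp: lower_def)
  let ?S = "sigma (sturmian \<theta>) (range (lower \<theta>))"
  show "sigma_sets (sturmian \<theta>) (range (lower \<theta>)) \<subseteq> sets ?R"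
    using sets.sigma_sets_subset[of "range (lower \<theta>)" ?R] lower_sets by (auto simp: space_restrict_space)
  have lower: "lower \<theta> k \<in> sets ?S" for k
    using sub by (auto intro: sigma_sets.Basic)
  have height: "(\<lambda>w. real_of_int (height w k)) \<in> borel_measurable ?S" for k
  proof (subst measurable_cong)
    show "real_of_int (height w k) = (of_int \<lfloor>of_int k * \<theta>\<rfloor> + 1) - indicator (lower \<theta> k) w" if "w \<in> space ?S" for w
      using height_cases[OF \<theta>, of w k] that sub by (auto simp: space_measure_of lower_def indicator_def)
    show "(\<lambda>w. (of_int \<lfloor>of_int k * \<theta>\<rfloor> + 1) - indicator (lower \<theta> k) w :: real) \<in> borel_measurable ?S"
      using lower[of k] by measurable
  qed
  have coord: "(\<lambda>w. w i) \<in> borel_measurable ?S" for i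
  proof -
    have "(\<lambda>w. nat \<lfloor>real_of_int (height w (i + 1)) - real_of_int (height w i)\<rfloor>) \<in> borel_measurable ?S"
      using height[of i] height[of "i + 1"] by measurable
    moreover have "nat \<lfloor>real_of_int (height w (i + 1)) - real_of_int (height w i)\<rfloor> = w i" for w
      by (simp add: height_step)
    ultimately show ?thesis by simp
  qed
  have "(\<lambda>w. w) \<in> measurable ?S (Pi\<^sub>M UNIV (\<lambda>_. borel))"
    by (rule measurable_PiM_single') (auto intro: coord)
  then have id: "(\<lambda>w. w) \<in> borel_measurable ?S"
    by (simp only: measurable_cong_sets[OF refl sets_PiM_equal_borel])
  show "sets ?R \<subseteq> sigma_sets (sturmian \<theta>) (range (lower \<theta>))"
  proof
    fix A assume "A \<in> sets ?R"
    then obtain B where "B \<in> sets borel" "A = B \<inter> sturmian \<theta>"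
      by (auto simp: sets_restrict_space)
    then have "A \<in> sets ?S"
      using measurable_sets[OF id, of B] sub by (simp add: space_measure_of)
    then show "A \<in> sigma_sets (sturmian \<theta>) (range (lower \<theta>))" using sub by simp
  qed
qed

text \<open>
  The generating sets form a chain and are therefore stable under intersection.
\<close>

lemma invariant_probability_unique:
  assumes \<theta>: "0 < \<theta>" "\<theta> < 1"
    and inv: "invariant_probability (sturmian \<theta>) M" "invariant_probability (sturmian \<theta>) N"
  shows "M = N"
proof (rule measure_eqI_generator_eq)
  show "Int_stable (range (lower \<theta>))"
  proof (rule Int_stableI)
    fix A B assume "A \<in> range (lower \<theta>)" "B \<in> range (lower \<theta>)"
    then obtain k l where AB: "A = lower \<theta> k" "B = lower \<theta> l" by blast
    have "A \<subseteq> B \<or> B \<subseteq> A"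
      unfolding AB using lower_mono[OF \<theta>, of l k] lower_mono[OF \<theta>, of k l] by linarith
    then show "A \<inter> B \<in> range (lower \<theta>)"
      unfolding AB by (auto simp: Int_absorb1 Int_absorb2)
  qed
  show "range (lower \<theta>) \<subseteq> Pow (sturmian \<theta>)" by (auto simp: lower_def)
  show "sets M = sigma_sets (sturmian \<theta>) (range (lower \<theta>))" "sets N = sigma_sets (sturmian \<theta>) (range (lower \<theta>))"
    using inv by (simp_all add: invariant_probability_def sets_sturmian_eq[OF \<theta>])
  interpret M: prob_space M using inv by (simp add: invariant_probability_def)
  interpret N: prob_space N using inv by (simp add: invariant_probability_def)
  show "emeasure M A = emeasure N A" if "A \<in> range (lower \<theta>)" for A
    using that measure_lower[OF \<theta>] inv by (auto simp: M.emeasure_eq_measure N.emeasure_eq_measure)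
  show "range (\<lambda>_::nat. sturmian \<theta>) \<subseteq> range (lower \<theta>)" using lower_0 by blast
  show "emeasure M (sturmian \<theta>) \<noteq> \<infinity>" by simp
qed auto

lemma circle_rotation_measurable:
  fixes \<theta> :: real
  shows "(\<lambda>y. frac (y + \<theta>)) \<in> measurable (restrict_space lborel {0..<1}) (restrict_space lborel {0..<1})"
proof (rule measurable_restrict_space3)
  show "(\<lambda>y. frac (y + \<theta>)) \<in> lborel \<rightarrow>\<^sub>M lborel" unfolding frac_def by measurable
  show "(\<lambda>y. frac (y + \<theta>)) \<in> {0..<1} \<rightarrow> {0..<1}" by (auto simp: frac_lt_1)
qed

text \<open>
  The rotation translates \<open>{0..<1 - \<theta>}\<close> to \<open>{\<theta>..<1}\<close> and the rest of the circle to \<open>{0..<\<theta>}\<close>.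
\<close>

lemma circle_rotation_invariant:
  fixes \<theta> :: real
  assumes \<theta>: "0 < \<theta>" "\<theta> < 1"
  defines "U \<equiv> restrict_space lborel {0..<1::real}"
  shows "distr U U (\<lambda>y. frac (y + \<theta>)) = U"
proof (rule measure_eqI)
  fix A assume "A \<in> sets (distr U U (\<lambda>y. frac (y + \<theta>)))"
  then have "A \<in> sets U" by simp
  then have A: "A \<in> sets borel" "A \<subseteq> {0..<1}"
    by (auto simp: U_def sets_restrict_space_iff)
  have space: "space U = {0..<1}" by (simp add: U_def space_restrict_space)
  have restr: "emeasure U B = emeasure lborel B" if "B \<subseteq> {0..<1}" for B
    unfolding U_def using that by (intro emeasure_restrict_space) auto
  have transl: "emeasure lborel {y. y + c \<in> B} = emeasure lborel B" if "B \<in> sets borel" for B and c :: real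
  proof -
    have "emeasure lborel B = emeasure (distr lborel borel ((+) c)) B" by (simp add: lborel_distr_plus)
    also have "\<dots> = emeasure lborel {y. y + c \<in> B}"
      using that by (subst emeasure_distr) (auto simp: vimage_def add.commute)
    finally show ?thesis ..
  qed
  have rot_eq: "frac (y + \<theta>) = (if y < 1 - \<theta> then y + \<theta> else y + (\<theta> - 1))" if "y \<in> {0..<1}" for y
  proof (cases "y < 1 - \<theta>")
    case True
    then have "frac (y + \<theta>) = y + \<theta>" using that \<theta> by (intro frac_eq[THEN iffD2]) auto
    then show ?thesis using True by simp
  next
    case False
    have "frac (y + \<theta>) = frac (y + (\<theta> - 1))"
      using frac_1_eq[of "y + (\<theta> - 1)"] by (simp only: diff_add_cancel add.assoc)
    also have "\<dots> = y + (\<theta> - 1)" using False that \<theta> by (intro frac_eq[THEN iffD2]) auto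
    finally show ?thesis using False by simp
  qed
  have "(\<lambda>y. frac (y + \<theta>)) -` A \<inter> space U
      = {y. y + \<theta> \<in> A \<inter> {\<theta>..<1}} \<union> {y. y + (\<theta> - 1) \<in> A \<inter> {0..<\<theta>}}"
    using A(2) \<theta> unfolding space by (auto simp: rot_eq split: if_splits)
  then have "emeasure (distr U U (\<lambda>y. frac (y + \<theta>))) A
      = emeasure U ({y. y + \<theta> \<in> A \<inter> {\<theta>..<1}} \<union> {y. y + (\<theta> - 1) \<in> A \<inter> {0..<\<theta>}})"
    using \<open>A \<in> sets U\<close> by (simp add: emeasure_distr[OF circle_rotation_measurable[folded U_def]])
  also have "\<dots> = emeasure lborel ({y. y + \<theta> \<in> A \<inter> {\<theta>..<1}} \<union> {y. y + (\<theta> - 1) \<in> A \<inter> {0..<\<theta>}})"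
    using \<theta> by (intro restr) auto
  also have "\<dots> = emeasure lborel {y. y + \<theta> \<in> A \<inter> {\<theta>..<1}} + emeasure lborel {y. y + (\<theta> - 1) \<in> A \<inter> {0..<\<theta>}}"
  proof (rule plus_emeasure[symmetric])
    show "{y. y + \<theta> \<in> A \<inter> {\<theta>..<1}} \<in> sets lborel" "{y. y + (\<theta> - 1) \<in> A \<inter> {0..<\<theta>}} \<in> sets lborel"
      using A(1) by measurable
  qed auto
  also have "\<dots> = emeasure lborel (A \<inter> {\<theta>..<1}) + emeasure lborel (A \<inter> {0..<\<theta>})"
  proof -
    have "A \<inter> {\<theta>..<1} \<in> sets borel" "A \<inter> {0..<\<theta>} \<in> sets borel" using A(1) by auto
    then show ?thesis by (simp only: transl)
  qed
  also have "\<dots> = emeasure lborel ((A \<inter> {\<theta>..<1}) \<union> (A \<inter> {0..<\<theta>}))"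
    using A(1) by (intro plus_emeasure) auto
  also have "(A \<inter> {\<theta>..<1}) \<union> (A \<inter> {0..<\<theta>}) = A" using A(2) \<theta> by auto
  also have "emeasure lborel A = emeasure U A" using A(2) by (simp add: restr)
  finally show "emeasure (distr U U (\<lambda>y. frac (y + \<theta>))) A = emeasure U A" .
qed simp

text \<open>
  The coding intertwines the rotation of the circle with the shift, so it transports Lebesgue measure to
  an invariant measure.
\<close>

lemma invariant_probability_exists:
  assumes \<theta>: "0 < \<theta>" "\<theta> < 1"
  shows "\<exists>M. invariant_probability (sturmian \<theta>) M"
proof -
  define U where "U = restrict_space lborel {0..<1::real}"
  let ?R = "restrict_space borel (sturmian \<theta>)"
  have "(\<lambda>y. coding \<theta> y i) \<in> borel_measurable borel" for i
    unfolding coding_def by measurable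
  then have "coding \<theta> \<in> measurable borel (Pi\<^sub>M UNIV (\<lambda>_. borel))"
    by (intro measurable_PiM_single') auto
  then have "coding \<theta> \<in> borel_measurable borel"
    by (simp only: measurable_cong_sets[OF refl sets_PiM_equal_borel])
  then have coding: "coding \<theta> \<in> measurable U ?R"
    unfolding U_def using coding_in_sturmian[OF \<theta>]
    by (intro measurable_restrict_space2 measurable_restrict_space1) auto
  have "emeasure U (space U) = 1"
    by (simp add: U_def space_restrict_space emeasure_restrict_space)
  then interpret U: prob_space U by (rule prob_spaceI)
  have equivariant: "shift (coding \<theta> y) = coding \<theta> (frac (y + \<theta>))" for y
  proof -
    have "of_int i * \<theta> + frac (y + \<theta>) = of_int (i + 1) * \<theta> + y - of_int \<lfloor>y + \<theta>\<rfloor>" for i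
      by (simp add: frac_def algebra_simps)
    then show ?thesis unfolding shift_def coding_def fun_eq_iff by (simp only: floor_diff_of_int) simp
  qed
  let ?M = "distr U ?R (coding \<theta>)"
  have "distr ?M ?M shift = distr ?M ?R shift" by (rule distr_cong) auto
  also have "\<dots> = distr U ?R (shift \<circ> coding \<theta>)"
    by (rule distr_distr[OF shift_measurable coding])
  also have "shift \<circ> coding \<theta> = coding \<theta> \<circ> (\<lambda>y. frac (y + \<theta>))"
    by (simp add: fun_eq_iff equivariant)
  also have "distr U ?R (coding \<theta> \<circ> (\<lambda>y. frac (y + \<theta>))) = distr (distr U U (\<lambda>y. frac (y + \<theta>))) ?R (coding \<theta>)"
    by (rule distr_distr[OF coding circle_rotation_measurable[folded U_def], symmetric])
  also have "distr U U (\<lambda>y. frac (y + \<theta>)) = U"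
    unfolding U_def by (rule circle_rotation_invariant[OF \<theta>])
  finally have "distr ?M ?M shift = ?M" .
  then have "invariant_probability (sturmian \<theta>) ?M"
    unfolding invariant_probability_def using U.prob_space_distr[OF coding] by simp
  then show ?thesis ..
qed

lemma invariant_measure_sturmian:
  assumes "0 < \<theta>" "\<theta> < 1"
  shows "invariant_probability (sturmian \<theta>) (invariant_measure (sturmian \<theta>))"
  unfolding invariant_measure_def
  using invariant_probability_exists[OF assms] invariant_probability_unique[OF assms]
  by (metis theI)

section \<open>Very well approximable numbers\<close>

text \<open>
  The exponent \<open>5\<close> is the sum of \<open>4\<close>, from the square of the factor \<open>n\<^sup>2\<close> in the bound for the commutator with
  \<open>n\<close> about \<open>2 * q\<close>, and \<open>1\<close>, from the long arc having length about \<open>1 / q\<close>.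
\<close>

definition well_approximable :: "real \<Rightarrow> bool" where
  "well_approximable \<theta> \<longleftrightarrow> (\<forall>C. \<exists>(p::int) (q::nat). 0 < q \<and> coprime p (int q) \<and>
     0 < real q * \<theta> - of_int p \<and> C * real q ^ 5 * (real q * \<theta> - of_int p) < 1)"

text \<open>
  If \<open>\<theta>\<close> has denominator \<open>s\<close>, then a positive \<open>q * \<theta> - p\<close> is at least \<open>1 / s\<close>.
\<close>

lemma well_approximable_irrational:
  assumes "well_approximable \<theta>" shows "\<theta> \<notin> \<rat>"
proof
  assume "\<theta> \<in> \<rat>"
  then obtain r s :: int where s: "0 < s" and \<theta>: "\<theta> = of_int r / of_int s"
    by (metis Rats_cases')
  obtain p :: int and q :: nat where q: "0 < q" and pos: "0 < real q * \<theta> - of_int p"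
    and small: "of_int s * real q ^ 5 * (real q * \<theta> - of_int p) < 1"
    using assms unfolding well_approximable_def by blast
  have int: "of_int s * (real q * \<theta> - of_int p) = of_int (int q * r - p * s)"
    using s by (simp add: \<theta> field_simps)
  have "0 < of_int s * (real q * \<theta> - of_int p)"
    using s pos by simp
  then have "1 \<le> of_int s * (real q * \<theta> - of_int p)"
    unfolding int of_int_0_less_iff of_int_1_le_iff by linarith
  moreover have "1 \<le> real q ^ 5" using q by simp
  ultimately have "1 * 1 \<le> (of_int s * (real q * \<theta> - of_int p)) * real q ^ 5"
    by (intro mult_mono) auto
  then show False using small by (simp add: mult_ac)
qed

text \<open>
  A lacunary binary expansion with ones at the places \<open>7 ^ k\<close>. Cut off after the place \<open>7 ^ n\<close>, it is a
  fraction with denominator \<open>q = 2 ^ 7 ^ n\<close> and odd numerator, and the next nonzero digit is of size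
  \<open>1 / q ^ 7\<close>; so \<open>q * \<theta> - p\<close> is at most \<open>2 / q ^ 6\<close>.
\<close>

lemma well_approximable_exists: "\<exists>\<theta>. 0 < \<theta> \<and> \<theta> < 1 \<and> well_approximable \<theta>"
proof -
  define t :: "nat \<Rightarrow> real" where "t k = (1/2) ^ (7 ^ k)" for k
  have pow: "7 ^ m + k \<le> (7::nat) ^ (k + m)" for k m
  proof (induction k)
    case (Suc k)
    have "(1::nat) \<le> 7 ^ (k + m)" by simp
    then show ?case using Suc unfolding add_Suc power_Suc by linarith
  qed simp
  have t_le: "t (k + m) \<le> (1/2) ^ (7 ^ m) * (1/2) ^ k" for k m
    unfolding t_def power_add[symmetric] by (rule power_decreasing[OF pow]) auto
  have geo: "(\<lambda>k. c * (1/2) ^ k) sums (c * 2)" for c :: real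
    using sums_mult[OF geometric_sums[of "1/2::real"], of c] by simp
  have summ: "summable (\<lambda>k. t (k + m))" for m
    by (rule summable_comparison_test_ev[OF _ sums_summable[OF geo[of "(1/2) ^ (7 ^ m)"]]])
       (use t_le[of _ m] in \<open>auto simp: t_def\<close>)
  have tail_le: "(\<Sum>k. t (k + m)) \<le> 2 * (1/2) ^ (7 ^ m)" for m
    using suminf_le[OF t_le summ[of m] sums_summable[OF geo]] sums_unique[OF geo[of "(1/2) ^ (7 ^ m)"]]
    by (simp only: mult.commute)
  have tail_pos: "0 < (\<Sum>k. t (k + m))" for m
    by (rule suminf_pos[OF summ]) (simp add: t_def)
  define \<theta> where "\<theta> = (\<Sum>k. t k)"
  have split: "\<theta> = (\<Sum>k. t (k + m)) + (\<Sum>k<m. t k)" for m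
    unfolding \<theta>_def by (rule suminf_split_initial_segment) (use summ[of 0] in simp)
  have "0 < \<theta>" using tail_pos[of 0] by (simp add: \<theta>_def)
  moreover have "\<theta> < 1" using split[of 1] tail_le[of 1] by (simp add: t_def power_divide)
  moreover have "well_approximable \<theta>"
    unfolding well_approximable_def
  proof
    fix C :: real
    obtain n :: nat where n: "2 * \<bar>C\<bar> < real n" using reals_Archimedean2 by blast
    define q :: nat where "q = 2 ^ (7 ^ n)"
    define p :: int where "p = (\<Sum>k<Suc n. 2 ^ (7 ^ n - 7 ^ k))"
    have q: "0 < q" by (simp add: q_def)
    have "Suc n \<le> 7 ^ n" using pow[of 0 n] by simp
    also have "\<dots> < q" unfolding q_def by (rule less_exp)
    finally have "n < q" by simp
    have "even (\<Sum>k<n. (2::int) ^ (7 ^ n - 7 ^ k))"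
    proof (rule dvd_sum)
      fix k assume "k \<in> {..<n}"
      then have "(7::nat) ^ k < 7 ^ n" by simp
      then show "even ((2::int) ^ (7 ^ n - 7 ^ k))" by simp
    qed
    then have "odd p" by (simp add: p_def)
    then have "coprime p (int q)" by (simp add: q_def)
    have "real q * t k = 2 ^ (7 ^ n - 7 ^ k)" if "k < Suc n" for k
    proof -
      have "(7::nat) ^ k \<le> 7 ^ n" using that by (intro power_increasing) auto
      then show ?thesis by (simp add: q_def t_def power_diff power_divide)
    qed
    then have "real q * (\<Sum>k<Suc n. t k) = of_int p"
      unfolding p_def sum_distrib_left of_int_sum by (intro sum.cong) auto
    then have \<delta>: "real q * \<theta> - of_int p = real q * (\<Sum>k. t (k + Suc n))"
      using split[of "Suc n"] by (simp add: distrib_left)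
    have q7: "(1/2::real) ^ (7 ^ Suc n) = 1 / real q ^ 7"
    proof -
      have "(7::nat) ^ Suc n = 7 ^ n * 7" by simp
      then show ?thesis unfolding power_mult q_def by (simp only: power_mult) (simp add: power_divide)
    qed
    have "C * real q ^ 5 * (real q * \<theta> - of_int p) \<le> \<bar>C\<bar> * real q ^ 5 * (real q * (2 * (1 / real q ^ 7)))"
      using tail_le[of "Suc n"] tail_pos[of "Suc n"] unfolding \<delta> q7
      by (intro mult_mono) auto
    also have "\<dots> = 2 * \<bar>C\<bar> / real q"
      using q by (simp add: field_simps power_numeral_reduce)
    also have "\<dots> < 1" using n \<open>n < q\<close> by simp
    finally have "C * real q ^ 5 * (real q * \<theta> - of_int p) < 1" .
    moreover have "0 < real q * \<theta> - of_int p"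
      unfolding \<delta> by (rule mult_pos_pos[OF _ tail_pos]) (use q in simp)
    ultimately show "\<exists>(p::int) (q::nat). 0 < q \<and> coprime p (int q) \<and>
        0 < real q * \<theta> - of_int p \<and> C * real q ^ 5 * (real q * \<theta> - of_int p) < 1"
      using q \<open>coprime p (int q)\<close> by blast
  qed
  ultimately show ?thesis by blast
qed

text \<open>
  The multiple \<open>k * \<theta>\<close> is a fraction with denominator \<open>q\<close> displaced by \<open>k * \<delta> / q\<close>, with
  \<open>\<delta> = q * \<theta> - p\<close>, so its distance to the next integer is at least \<open>1 / q\<close> up to this displacement. For
  negative \<open>k\<close> the displacement is to the left and could cross an integer; but then \<open>k * p\<close> is not
  divisible by \<open>q\<close>, because \<open>k\<close> is greater than \<open>- q\<close>. For \<open>k = - q\<close> the bound fails, and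
  this is the multiple that makes the uneven cut.
\<close>

lemma frac_multiple_le:
  fixes p k :: int and q :: nat and \<theta> :: real
  assumes q: "0 < q" and cop: "coprime p (int q)"
    and \<delta>: "0 < real q * \<theta> - of_int p" "4 * real q * (real q * \<theta> - of_int p) \<le> 1"
    and k: "1 - int q \<le> k" "k \<le> int q + 1"
  shows "frac (of_int k * \<theta>) \<le> 1 - 1 / (2 * real q)"
proof -
  define \<delta> where "\<delta> = real q * \<theta> - of_int p"
  define m r where "m = (k * p) div int q" and "r = (k * p) mod int q"
  have kp: "k * p = m * int q + r" by (simp add: m_def r_def)
  have r: "0 \<le> r" "r \<le> int q - 1" using q by (simp_all add: r_def pos_mod_bound[of "int q", simplified])
  have "real q * (of_int k * \<theta>) = of_int (k * p) + of_int k * \<delta>"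
    by (simp add: \<delta>_def algebra_simps)
  then have eq: "real q * (of_int k * \<theta> - of_int m) = of_int r + of_int k * \<delta>"
    unfolding kp by (simp add: algebra_simps)
  have q1: "1 \<le> real q" using q by simp
  have d: "0 < \<delta>" "4 * real q * \<delta> \<le> 1" using assms(3,4) by (simp_all add: \<delta>_def)
  have "of_int k * \<delta> \<le> (2 * real q) * \<delta>"
    using d(1) k(2) q1 by (intro mult_right_mono) linarith+
  then have up: "of_int k * \<delta> \<le> 1 / 2" using d(2) by linarith
  have low: "0 \<le> of_int r + of_int k * \<delta>"
  proof (cases "0 \<le> k")
    case True
    then show ?thesis using r(1) d(1) by simp
  next
    case False
    have "\<not> int q dvd k" using False k(1) by (auto dest: zdvd_imp_le[of "int q" "- k", simplified])
    then have "\<not> int q dvd k * p" using cop by (simp add: coprime_dvd_mult_left_iff coprime_commute)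
    then have "1 \<le> r" using r(1) by (auto simp: r_def dvd_eq_mod_eq_0)
    moreover have "- (real q * \<delta>) \<le> of_int k * \<delta>"
      using mult_right_mono[of "- real q" "of_int k" \<delta>] d(1) k(1) by simp
    ultimately show ?thesis using d(2) by linarith
  qed
  have "real q * (of_int k * \<theta> - of_int m) \<le> real q - 1 / 2"
    unfolding eq using r(2) up by linarith
  then have le: "of_int k * \<theta> - of_int m \<le> 1 - 1 / (2 * real q)"
    using q1 by (simp add: field_simps)
  have "0 \<le> of_int k * \<theta> - of_int m"
    using low q1 unfolding eq[symmetric] by (simp add: zero_le_mult_iff)
  moreover have "0 < 1 / (2 * real q)" using q1 by simp
  ultimately have "\<lfloor>of_int k * \<theta>\<rfloor> = m"
    using le by (intro floor_unique) linarith+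
  then show ?thesis using le by (simp add: frac_def)
qed

section \<open>Separating two points by an infinite distance\<close>

lemma is_state_point:
  assumes "x \<in> X" shows "is_state X (\<lambda>f. f x)"
  using assms by (simp add: is_state_def)

text \<open>
  Two fixed points suffice, as evaluations at points are states.
\<close>

lemma infinite_connes_dist:
  assumes "x \<in> X" "y \<in> X"
    and large: "\<And>R. \<exists>f \<in> C_inf X. commutator_norm X M f \<le> 1 \<and> R \<le> cmod (f x - f y)"
  shows "connes_metric_infinite X M"
proof
  assume "connes_metric_finite X M"
  then have "connes_dist X M (\<lambda>f. f x) (\<lambda>f. f y) < \<infinity>"
    using assms(1,2) by (simp add: connes_metric_finite_def is_state_point)
  then obtain r where r: "0 \<le> r" "connes_dist X M (\<lambda>f. f x) (\<lambda>f. f y) = ennreal r"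
    by (cases "connes_dist X M (\<lambda>f. f x) (\<lambda>f. f y)") auto
  obtain f where f: "f \<in> C_inf X" "commutator_norm X M f \<le> 1" "r + 1 \<le> cmod (f x - f y)"
    using large by blast
  have "ennreal (r + 1) \<le> ennreal (cmod (f x - f y))" using f(3) by (rule ennreal_leI)
  also have "\<dots> \<le> connes_dist X M (\<lambda>f. f x) (\<lambda>f. f y)"
    unfolding connes_dist_def by (rule SUP_upper) (use f in simp)
  finally show False using r by (simp add: ennreal_le_iff)
qed

lemma subshift_measure_sturmian:
  assumes "0 < \<theta>" "\<theta> < 1"
  shows "subshift_measure (invariant_measure (sturmian \<theta>)) (sturmian \<theta>)"
proof -
  have inv: "invariant_probability (sturmian \<theta>) (invariant_measure (sturmian \<theta>))"
    by (rule invariant_measure_sturmian[OF assms])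
  then interpret prob_space "invariant_measure (sturmian \<theta>)"
    by (simp add: invariant_probability_def)
  show ?thesis
    by unfold_locales
      (use inv in \<open>auto simp: invariant_probability_def sturmian_translate finite_words_sturmian\<close>)
qed

lemma measure_Inter_lower:
  assumes \<theta>: "0 < \<theta>" "\<theta> < 1" and inv: "invariant_probability (sturmian \<theta>) M"
    and S: "finite S" "S \<noteq> {}"
  obtains k where "k \<in> S" "measure M (\<Inter>k\<in>S. lower \<theta> k) = 1 - frac (of_int k * \<theta>)"
proof -
  obtain k where k: "k \<in> S" "\<And>l. l \<in> S \<Longrightarrow> frac (of_int l * \<theta>) \<le> frac (of_int k * \<theta>)"
    using Max_in[of "(\<lambda>k. frac (of_int k * \<theta>)) ` S"] Max_ge[of "(\<lambda>k. frac (of_int k * \<theta>)) ` S"] S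
    by (metis (no_types, lifting) finite_imageI image_iff image_is_empty imageI)
  have "(\<Inter>k\<in>S. lower \<theta> k) = lower \<theta> k"
    using k lower_mono[OF \<theta> k(2)] by blast
  then show thesis using that k(1) measure_lower[OF \<theta> inv] by simp
qed

text \<open>
  All heights of the itinerary of \<open>0\<close> are \<open>\<lfloor>k * \<theta>\<rfloor>\<close>, so agreeing with it on a window means
  having the lower height at all places from the left end of the window to one past its right end.
\<close>

lemma coding_cylinder_eq:
  assumes \<theta>: "0 < \<theta>" "\<theta> < 1" and n: "0 < n"
  shows "cylinder (sturmian \<theta>) (map (coding \<theta> 0) (window n))
    = (\<Inter>k\<in>{1 - int (Suc n div 2)..int (n div 2) + 1}. lower \<theta> k)" (is "_ = (\<Inter>k\<in>?S. _)")
proof (intro equalityI subsetI)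
  have agree: "(\<forall>i\<in>set (window n). w i = coding \<theta> 0 i) \<longleftrightarrow> (\<forall>k\<in>?S. height w k = \<lfloor>of_int k * \<theta>\<rfloor>)" for w
    using height_agree_iff[of "1 - int (Suc n div 2)" "int (n div 2)" w "coding \<theta> 0"] n
    by (simp add: window_eq height_coding[OF \<theta>])
  fix w
  {
    assume "w \<in> cylinder (sturmian \<theta>) (map (coding \<theta> 0) (window n))"
    then show "w \<in> (\<Inter>k\<in>?S. lower \<theta> k)"
      using agree[of w] by (auto simp: cylinder_def length_window lower_def)
  next
    assume w: "w \<in> (\<Inter>k\<in>?S. lower \<theta> k)"
    have "0 \<in> ?S" using n by simp
    then have "w \<in> lower \<theta> 0" using w by blast
    then have "w \<in> sturmian \<theta>" by (simp add: lower_def)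
    moreover have "\<forall>k\<in>?S. height w k = \<lfloor>of_int k * \<theta>\<rfloor>" using w by (auto simp: lower_def)
    ultimately show "w \<in> cylinder (sturmian \<theta>) (map (coding \<theta> 0) (window n))"
      using agree[of w] by (simp add: cylinder_def length_window)
  }
qed

text \<open>
  The cylinders around the itinerary of \<open>0\<close> are \<open>I\<close>, from the places \<open>1 - q, \<dots>, q + 1\<close>, and \<open>J\<close>, for
  which the place \<open>- q\<close> is added. By \<open>frac_multiple_le\<close> the measure of \<open>I\<close> is at least \<open>1 / (2 * q)\<close>,
  while \<open>J\<close> is contained in \<open>lower \<theta> (- q)\<close>, of measure \<open>q * \<theta> - p\<close>.
\<close>

lemma coding_separated:
  assumes \<theta>: "0 < \<theta>" "\<theta> < 1" and q: "0 < q" "coprime p (int q)"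
    and \<delta>: "0 < real q * \<theta> - of_int p" "8 * real q * (real q * \<theta> - of_int p) \<le> 1"
  shows "\<exists>f \<in> C_inf (sturmian \<theta>). commutator_norm (sturmian \<theta>) (invariant_measure (sturmian \<theta>)) f \<le> 1 \<and>
    1 / (36 * sqrt (real q ^ 5 * (real q * \<theta> - of_int p))) \<le> cmod (f (coding \<theta> 0) - f (coding \<theta> (1/2)))"
proof -
  define \<delta> where "\<delta> = real q * \<theta> - of_int p"
  have d: "0 < \<delta>" "8 * real q * \<delta> \<le> 1" using \<delta> by (simp_all add: \<delta>_def)
  have q1: "1 \<le> real q" using q by simp
  have "8 * \<delta> \<le> 8 * real q * \<delta>" using q1 d(1) by simp
  then have d8: "8 * \<delta> \<le> 1" using d(2) by linarith
  let ?X = "sturmian \<theta>"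
  let ?M = "invariant_measure ?X"
  let ?w = "coding \<theta> 0" and ?v = "coding \<theta> (1/2)"
  have inv: "invariant_probability ?X ?M" by (rule invariant_measure_sturmian[OF \<theta>])
  interpret subshift_measure ?M ?X by (rule subshift_measure_sturmian[OF \<theta>])
  \<comment> \<open>The windows of length \<open>2 * q\<close> and \<open>2 * q + 1\<close> are \<open>1 - q, \<dots>, q\<close> and \<open>- q, \<dots>, q\<close>.\<close>
  let ?n = "2 * q + 1"
  define I J where "I = cylinder ?X (map ?w (window (?n - 1)))" and "J = cylinder ?X (map ?w (window ?n))"
  have I: "I = (\<Inter>k\<in>{1 - int q..int q + 1}. lower \<theta> k)"
    unfolding I_def using coding_cylinder_eq[OF \<theta>, of "2 * q"] q by simp
  have J: "J = (\<Inter>k\<in>{- int q..int q + 1}. lower \<theta> k)"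
    unfolding J_def using coding_cylinder_eq[OF \<theta>, of ?n] q by simp
  have mq: "of_int (- int q) * \<theta> = - of_int p - \<delta>" by (simp add: \<delta>_def)
  have floor_mq: "\<lfloor>of_int (- int q) * \<theta>\<rfloor> = - p - 1"
    unfolding mq using d(1) d8 by (simp add: floor_eq_iff)
  \<comment> \<open>Here the itinerary of \<open>1 / 2\<close> leaves \<open>J\<close>: at the place \<open>- q\<close> its height is not the lower one.\<close>
  have floor_v: "\<lfloor>of_int (- int q) * \<theta> + 1/2\<rfloor> = - p"
    unfolding mq using d(1) d8 by (simp add: floor_eq_iff)
  have J_sub: "J \<subseteq> lower \<theta> (- int q)" unfolding J by auto
  have "prob J \<le> prob (lower \<theta> (- int q))"
    using J_sub lower_sets[of \<theta> "- int q"] sets_eq by (intro finite_measure_mono) auto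
  also have "\<dots> = 1 - frac (of_int (- int q) * \<theta>)" by (rule measure_lower[OF \<theta> inv])
  also have "\<dots> = \<delta>" unfolding frac_def floor_mq unfolding mq by simp
  finally have J_le: "prob J \<le> \<delta>" .
  obtain k where "prob J = 1 - frac (of_int k * \<theta>)"
    unfolding J by (rule measure_Inter_lower[OF \<theta> inv, of "{- int q..int q + 1}"]) auto
  then have J_pos: "0 < prob J" using frac_lt_1[of "of_int k * \<theta>"] by simp
  obtain l where l: "l \<in> {1 - int q..int q + 1}" "prob I = 1 - frac (of_int l * \<theta>)"
    unfolding I by (rule measure_Inter_lower[OF \<theta> inv, of "{1 - int q..int q + 1}"]) auto
  have "frac (of_int l * \<theta>) \<le> 1 - 1 / (2 * real q)"
    using l(1) d by (intro frac_multiple_le[OF q]) (simp_all add: \<delta>_def)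
  then have I_ge: "1 / (2 * real q) \<le> prob I" using l(2) by simp
  have "\<delta> \<le> 1 / (8 * real q)" using d(2) q1 by (simp add: field_simps)
  also have "\<dots> \<le> 1 / (4 * real q)" using q1 by (simp add: field_simps)
  finally have "\<delta> \<le> 1 / (4 * real q)" .
  moreover have "1 / (2 * real q) = 1 / (4 * real q) + 1 / (4 * real q)" by simp
  ultimately have gap: "1 / (4 * real q) \<le> prob I - prob J" using I_ge J_le by linarith
  have "0 < 1 / (4 * real q)" using q1 by simp
  then have JI: "prob J < prob I" using gap by linarith
  obtain f where f: "f \<in> C_inf ?X" "commutator_norm ?X ?M f \<le> 1"
    and fw: "f ?w = of_real (sqrt ((prob I - prob J) / prob J) / (2 * (real ?n)\<^sup>2))"
    and off: "\<And>x. x \<notin> J \<Longrightarrow> \<exists>r\<le>0. f x = of_real r"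
    using haar_function[of ?n ?w] coding_in_sturmian[OF \<theta>, of 0] J_pos JI unfolding I_def J_def by auto
  have "height ?v (- int q) = - p"
    using height_coding[OF \<theta>, of "1/2" "- int q"] floor_v by simp
  then have "?v \<notin> lower \<theta> (- int q)" unfolding lower_def floor_mq by simp
  then obtain r where r: "r \<le> 0" "f ?v = of_real r" using off J_sub by blast
  let ?A = "sqrt ((prob I - prob J) / prob J) / (2 * (real ?n)\<^sup>2)"
  have "?A \<le> cmod (f ?w - f ?v)"
    unfolding fw r(2) of_real_diff[symmetric] norm_of_real using r(1) by linarith
  moreover have "1 / (36 * sqrt (real q ^ 5 * \<delta>)) \<le> ?A"
  proof -
    have "1 / (4 * real q * \<delta>) = (1 / (4 * real q)) / \<delta>" by simp
    also have "\<dots> \<le> (prob I - prob J) / prob J"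
      using gap J_le J_pos JI q1 by (intro frac_le) auto
    finally have ratio: "1 / (4 * real q * \<delta>) \<le> (prob I - prob J) / prob J" .
    have "sqrt (1 / (4 * real q * \<delta>)) / (2 * (3 * real q)\<^sup>2) \<le> ?A"
    proof (rule frac_le)
      show "0 \<le> sqrt ((prob I - prob J) / prob J)" using JI J_pos by simp
      show "sqrt (1 / (4 * real q * \<delta>)) \<le> sqrt ((prob I - prob J) / prob J)"
        using ratio by (rule real_sqrt_le_mono)
      show "2 * (real ?n)\<^sup>2 \<le> 2 * (3 * real q)\<^sup>2"
        using q1 by (intro mult_left_mono power_mono) auto
    qed simp
    moreover have "sqrt (1 / (4 * real q * \<delta>)) / (2 * (3 * real q)\<^sup>2) = 1 / (36 * sqrt (real q ^ 5 * \<delta>))"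
    proof -
      have "real q ^ 5 * \<delta> = (real q * \<delta>) * ((real q)\<^sup>2)\<^sup>2" by (simp add: power2_eq_square eval_nat_numeral)
      then have "sqrt (real q ^ 5 * \<delta>) = sqrt (real q * \<delta>) * (real q)\<^sup>2"
        by (simp only: real_sqrt_mult real_sqrt_abs) simp
      moreover have "sqrt (4 * real q * \<delta>) = 2 * sqrt (real q * \<delta>)"
        by (simp add: real_sqrt_mult)
      ultimately show ?thesis by (simp add: real_sqrt_divide power_mult_distrib)
    qed
    ultimately show ?thesis by simp
  qed
  ultimately show ?thesis using f unfolding \<delta>_def by (intro bexI[of _ f]) auto
qed

theorem theorem5p13:
  "\<exists>\<theta>::real. 0 < \<theta> \<and> \<theta> < 1 \<and> \<theta> \<notin> \<rat> \<and>
     connes_metric_infinite (sturmian \<theta>) (invariant_measure (sturmian \<theta>))"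
proof -
  obtain \<theta> :: real where \<theta>: "0 < \<theta>" "\<theta> < 1" and appr: "well_approximable \<theta>"
    using well_approximable_exists by blast
  have "connes_metric_infinite (sturmian \<theta>) (invariant_measure (sturmian \<theta>))"
  proof (rule infinite_connes_dist)
    show "coding \<theta> 0 \<in> sturmian \<theta>" "coding \<theta> (1/2) \<in> sturmian \<theta>"
      by (rule coding_in_sturmian[OF \<theta>])+
    fix R :: real
    \<comment> \<open>The summand \<open>8\<close> provides a hypothesis of \<open>coding_separated\<close>, and \<open>(36 * R)\<^sup>2\<close> turns its bound into \<open>R\<close>.\<close>
    obtain p :: int and q :: nat where q: "0 < q" "coprime p (int q)"
      and pos: "0 < real q * \<theta> - of_int p"
      and small: "(8 + (36 * R)\<^sup>2) * real q ^ 5 * (real q * \<theta> - of_int p) < 1"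
      using appr unfolding well_approximable_def by blast
    define \<epsilon> where "\<epsilon> = real q ^ 5 * (real q * \<theta> - of_int p)"
    have \<epsilon>: "0 < \<epsilon>" using q(1) pos by (simp add: \<epsilon>_def)
    have sum: "8 * \<epsilon> + (36 * R)\<^sup>2 * \<epsilon> < 1"
      using small by (simp add: \<epsilon>_def algebra_simps)
    have "real q ^ 1 \<le> real q ^ 5" using q(1) by (intro power_increasing) auto
    then have "8 * (real q * (real q * \<theta> - of_int p)) \<le> 8 * \<epsilon>"
      unfolding \<epsilon>_def using pos by simp
    moreover have "0 \<le> (36 * R)\<^sup>2 * \<epsilon>" using \<epsilon> by simp
    ultimately have "8 * (real q * (real q * \<theta> - of_int p)) \<le> 1"
      using sum by linarith
    then have "8 * real q * (real q * \<theta> - of_int p) \<le> 1"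
      by (simp only: mult.assoc)
    then obtain f where f: "f \<in> C_inf (sturmian \<theta>)"
        "commutator_norm (sturmian \<theta>) (invariant_measure (sturmian \<theta>)) f \<le> 1"
        "1 / (36 * sqrt \<epsilon>) \<le> cmod (f (coding \<theta> 0) - f (coding \<theta> (1/2)))"
      using coding_separated[OF \<theta> q pos] unfolding \<epsilon>_def by blast
    have "(36 * R * sqrt \<epsilon>)\<^sup>2 \<le> 1\<^sup>2"
      using sum \<epsilon> by (simp add: power_mult_distrib)
    then have "36 * R * sqrt \<epsilon> \<le> 1" by (rule power2_le_imp_le) simp
    then have "R \<le> 1 / (36 * sqrt \<epsilon>)" using \<epsilon> by (simp add: field_simps)
    then show "\<exists>f\<in>C_inf (sturmian \<theta>). commutator_norm (sturmian \<theta>) (invariant_measure (sturmian \<theta>)) f \<le> 1 \<and>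
        R \<le> cmod (f (coding \<theta> 0) - f (coding \<theta> (1/2)))"
      using f by (intro bexI[of _ f]) auto
  qed
  then show ?thesis using \<theta> well_approximable_irrational[OF appr] by blast
qed

end
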